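(* Consider the Bernoulli group testing model described in the context, with an arbitrary fixed rate $R$ satisfying $\frac12<R<1$ and with $k\le p^{1-c}$ for some constant $c>0$. Suppose that the following hypothesis holds: for every $\epsilon>0$ there exists a constant $C=C(\epsilon)$ such that, a.a.s. as $p\to+\infty$, for every integer $\ell\in\{0,1,\ldots,\lfloor(1-\epsilon)k\rfloor\}$, $$\left|\phi(\ell)-n_{\mathrm{pos}}F_{p'}\!\left(\tfrac{\ell}{k}\right)\right|\le C\ln k .$$ Then for every $\epsilon>0$ and every sequence $w_p\to+\infty$, asymptotically almost surely as $p\to+\infty$ the following holds: for all $\zeta_{p'},W_{p'}\in\{0,1,\ldots,k\}$ with $\zeta_{p'}\le(1-\epsilon)k$, $\zeta_{p'}+W_{p'}\le k$, $W_{p'}\ge w_p$, and all $H_{p'}>0$, the $(\zeta_{p'},W_{p'},H_{p'})$-Overlap Gap Property does not hold.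
   Context: Model. There are $p$ items, $k$ of which are defective; the defective set is uniformly random among $k$-subsets. One performs $n$ tests; independently over tests and items, each item is included in each test with probability $\nu/k$, where $\nu=\nu_k>0$ is the solution of $(1-\frac{\nu}{k})^k=\frac12$. A test is positive if it contains at least one defective item and negative otherwise. Asymptotics: $p\to+\infty$, with $k=k_p\to+\infty$, $k=o(p)$, and $n=n_p$ such that the rate $R=\log_2\binom{p}{k}/n$ is kept equal (up to integer rounding of $n$) to a fixed constant. A sequence of events $A_p$ holds asymptotically almost surely (a.a.s.) if $\Pr[A_p]\to1$. Let $\mathcal P\subseteq\{1,\dots,n\}$ be the set of indices of positive tests, $n_{\mathrm{pos}}=|\mathcal P|$. An item is potentially defective if it participates in no negative test; let $p'$ be the number of potentially defective items, and identify these items with $\{1,\dots,p'\}$. Let $\theta^*\in\{0,1\}^{p'}$ be the indicator vector of the defective items and, for $i\in\mathcal P$, let $X_i\in\{0,1\}^{p'}$ be the indicator vector of the potentially defective items participating in test $i$. For $\theta\in\{0,1\}^{p'}$ let $H(\theta)=|\{i\in\mathcal P:\langle X_i,\theta\rangle=0\}|$. For $\ell\in\{0,\dots,k\}$, $$\phi(\ell)=\min\{H(\theta):\theta\in\{0,1\}^{p'},\ \|\theta\|_0=k,\ \langle\theta,\theta^*\rangle=\ell\},$$ with the minimum over the empty set equal to $+\infty$. First moment function. Let $\alpha(x,y)=x\ln\frac{x}{y}+(1-x)\ln\frac{1-x}{1-y}$ (with $0\ln 0=0$). For $\lambda\in[0,1)$, $F_{p'}(\lambda)$ is the unique number in $[0,1-2^{\lambda-1}]$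 satisfying $$\alpha\big(F_{p'}(\lambda),1-2^{\lambda-1}\big)=\frac{\ln\left[\binom{k}{\lfloor\lambda k\rfloor}\binom{p'-k}{\lfloor(1-\lambda)k\rfloor}\right]}{n_{\mathrm{pos}}}$$ (for $\lambda=\ell/k$ the floors are $\ell$ and $k-\ell$; existence and uniqueness of the values used is part of the a.a.s. event). Overlap Gap Property. Let $W\in\{0,1,\dots,k-1\}$, $\zeta\in\{\lfloor k^2/p'\rfloor,\lfloor k^2/p'\rfloor+1,\dots,k-W-1\}$ and $H_0>0$. The $(\zeta,W,H_0)$-Overlap Gap Property (OGP) holds if there is $r\in\mathbb R$ such that: (1) every $\theta\in\{0,1\}^{p'}$ with $\|\theta\|_0=k$ and $H(\theta)\le r$ satisfies $\langle\theta,\theta^*\rangle\le\zeta$ or $\langle\theta,\theta^*\rangle\ge\zeta+W+1$; (2) there exist $\theta_1,\theta_2\in\{0,1\}^{p'}$ with $\|\theta_1\|_0=\|\theta_2\|_0=k$, $\langle\theta_1,\theta^*\rangle\le\zeta$, $\langle\theta_2,\theta^*\rangle\ge\zeta+W+1$ and $\max\{H(\theta_1),H(\theta_2)\}\le r$; (3) $\max\{H(\theta):\theta\in\{0,1\}^{p'},\|\theta\|_0=k,\ \zeta+1\le\langle\theta,\theta^*\rangle\le\zeta+W-1\}\ge r+H_0$ (the maximum over an empty set is $-\infty$). For parameters outside the stated ranges the OGP is considered not to hold. *)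

theory Defs
  imports "HOL-Probability.Probability"
begin

section \<open>Bernoulli group testing\<close>

text \<open>
  The equation \<open>(1 - v/k)^k = 1/2\<close> has a second positive solution (beyond \<open>k\<close>) when \<open>k\<close> is
  even; since \<open>v/k\<close> is used as a probability, the solution meant is the one with \<open>v \<le> k\<close>.
\<close>

definition nu :: "nat \<Rightarrow> real" where
  "nu k = (THE v. 0 < v \<and> v \<le> real k \<and> (1 - v / real k) ^ k = 1 / 2)"

lemma nu_ex1:
  assumes "0 < k"
  shows "\<exists>!v. 0 < v \<and> v \<le> real k \<and> (1 - v / real k) ^ k = 1 / 2"
proof (rule ex1I[of _ "real k * (1 - root k (1 / 2))"])
  have "0 < root k (1 / 2)" "root k (1 / 2) < 1"
    using assms by simp_all
  then show "0 < real k * (1 - root k (1 / 2)) \<and> real k * (1 - root k (1 / 2)) \<le> real k \<and>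
      (1 - real k * (1 - root k (1 / 2)) / real k) ^ k = 1 / 2"
    using assms by (simp add: mult_le_cancel_left1)
next
  fix v assume v: "0 < v \<and> v \<le> real k \<and> (1 - v / real k) ^ k = 1 / 2"
  then have "0 \<le> 1 - v / real k"
    using assms by (simp add: field_simps)
  with v have "root k (1 / 2) = 1 - v / real k"
    using assms by (metis real_root_power_cancel)
  then show "v = real k * (1 - root k (1 / 2))"
    using assms by (simp add: field_simps)
qed

text \<open>
  An outcome is a pair \<open>(D, A)\<close>: \<open>D\<close> is the defective set, and \<open>A (i, j)\<close> says that item \<open>j\<close>
  participates in test \<open>i\<close>. Items are \<open>1, \<dots>, p\<close> and tests are \<open>1, \<dots>, n\<close>.
\<close>

type_synonym outcome = "nat set \<times> (nat \<times> nat \<Rightarrow> bool)"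

definition group_testing :: "nat \<Rightarrow> nat \<Rightarrow> nat \<Rightarrow> outcome pmf" where
  "group_testing p k n =
     pair_pmf (pmf_of_set {D. D \<subseteq> {1..p} \<and> card D = k})
              (Pi_pmf ({1..n} \<times> {1..p}) False (\<lambda>_. bernoulli_pmf (nu k / real k)))"

definition aas :: "(nat \<Rightarrow> 'a pmf) \<Rightarrow> (nat \<Rightarrow> 'a \<Rightarrow> bool) \<Rightarrow> bool" where
  "aas M E \<longleftrightarrow> (\<lambda>p. measure_pmf.prob (M p) {\<omega>. E p \<omega>}) \<longlonglongrightarrow> 1"

definition pos_tests :: "nat \<Rightarrow> outcome \<Rightarrow> nat set" where
  "pos_tests n \<omega> = {i \<in> {1..n}. \<exists>j\<in>fst \<omega>. snd \<omega> (i, j)}"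

definition n_pos :: "nat \<Rightarrow> outcome \<Rightarrow> nat" where
  "n_pos n \<omega> = card (pos_tests n \<omega>)"

definition pot_def :: "nat \<Rightarrow> nat \<Rightarrow> outcome \<Rightarrow> nat set" where
  "pot_def p n \<omega> = {j \<in> {1..p}. \<forall>i\<in>{1..n} - pos_tests n \<omega>. \<not> snd \<omega> (i, j)}"

definition p_pot :: "nat \<Rightarrow> nat \<Rightarrow> outcome \<Rightarrow> nat" where
  "p_pot p n \<omega> = card (pot_def p n \<omega>)"


section \<open>Overlaps and the number of unexplained tests\<close>

text \<open>
  Instead of relabelling the potentially defective items as \<open>1, \<dots>, p'\<close>, vectors are indexed by
  the set \<open>J\<close> of these items: \<open>{0,1}^{p'}\<close> becomes \<open>bin_vecs J\<close>.
\<close>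

definition bin_vecs :: "nat set \<Rightarrow> (nat \<Rightarrow> nat) set" where
  "bin_vecs J = J \<rightarrow>\<^sub>E {0, 1}"

definition dot :: "nat set \<Rightarrow> (nat \<Rightarrow> nat) \<Rightarrow> (nat \<Rightarrow> nat) \<Rightarrow> nat" where
  "dot J u v = (\<Sum>j\<in>J. u j * v j)"

definition norm0 :: "nat set \<Rightarrow> (nat \<Rightarrow> nat) \<Rightarrow> nat" where
  "norm0 J u = card {j \<in> J. u j \<noteq> 0}"

definition theta_star :: "nat \<Rightarrow> nat \<Rightarrow> outcome \<Rightarrow> nat \<Rightarrow> nat" where
  "theta_star p n \<omega> = (\<lambda>j\<in>pot_def p n \<omega>. of_bool (j \<in> fst \<omega>))"

definition test_vec :: "nat \<Rightarrow> nat \<Rightarrow> outcome \<Rightarrow> nat \<Rightarrow> nat \<Rightarrow> nat" where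
  "test_vec p n \<omega> i = (\<lambda>j\<in>pot_def p n \<omega>. of_bool (snd \<omega> (i, j)))"

definition H :: "nat \<Rightarrow> nat \<Rightarrow> outcome \<Rightarrow> (nat \<Rightarrow> nat) \<Rightarrow> nat" where
  "H p n \<omega> \<theta> = card {i \<in> pos_tests n \<omega>. dot (pot_def p n \<omega>) (test_vec p n \<omega> i) \<theta> = 0}"

definition sparse_vecs :: "nat \<Rightarrow> nat \<Rightarrow> nat \<Rightarrow> outcome \<Rightarrow> (nat \<Rightarrow> nat) set" where
  "sparse_vecs p k n \<omega> = {\<theta> \<in> bin_vecs (pot_def p n \<omega>). norm0 (pot_def p n \<omega>) \<theta> = k}"

definition overlap :: "nat \<Rightarrow> nat \<Rightarrow> outcome \<Rightarrow> (nat \<Rightarrow> nat) \<Rightarrow> nat" where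
  "overlap p n \<omega> \<theta> = dot (pot_def p n \<omega>) \<theta> (theta_star p n \<omega>)"

text \<open>
  All minima and maxima below are over finite sets. Taking them as \<^typ>\<open>ereal\<close> infima and suprema
  gives \<open>\<infinity>\<close>, respectively \<open>-\<infinity>\<close>, on the empty set.
\<close>

definition phi :: "nat \<Rightarrow> nat \<Rightarrow> nat \<Rightarrow> outcome \<Rightarrow> nat \<Rightarrow> ereal" where
  "phi p k n \<omega> l =
     (INF \<theta> \<in> {\<theta> \<in> sparse_vecs p k n \<omega>. overlap p n \<omega> \<theta> = l}. ereal (real (H p n \<omega> \<theta>)))"


section \<open>First moment function\<close>

definition alpha :: "real \<Rightarrow> real \<Rightarrow> real" where
  "alpha x y = x * ln (x / y) + (1 - x) * ln ((1 - x) / (1 - y))"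

text \<open>
  The defining property of \<open>F(t)\<close>, with \<open>q\<close> standing for \<open>p'\<close> and \<open>m\<close> for the number of positive
  tests. The first two conjuncts rule out the junk values of division by \<open>0\<close> and of \<open>ln 0\<close>, where
  \<open>F(t)\<close> is undefined.
\<close>

definition is_first_moment :: "nat \<Rightarrow> nat \<Rightarrow> nat \<Rightarrow> real \<Rightarrow> real \<Rightarrow> bool" where
  "is_first_moment q k m t x \<longleftrightarrow>
     (let N = (k choose nat \<lfloor>t * real k\<rfloor>) * ((q - k) choose nat \<lfloor>(1 - t) * real k\<rfloor>)
      in 0 < m \<and> 0 < N \<and>
         x \<in> {0..1 - 2 powr (t - 1)} \<and>
         alpha x (1 - 2 powr (t - 1)) = ln (real N) / real m)"

definition first_moment :: "nat \<Rightarrow> nat \<Rightarrow> nat \<Rightarrow> real \<Rightarrow> real" where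
  "first_moment q k m t = (THE x. is_first_moment q k m t x)"

text \<open>
  The event that \<open>|\<phi>(l) - n_pos F(l/k)| \<le> B\<close>, including that \<open>F(l/k)\<close> is well defined.
  It fails if \<open>\<phi>(l) = \<infinity>\<close>.
\<close>

definition first_moment_close :: "nat \<Rightarrow> nat \<Rightarrow> nat \<Rightarrow> outcome \<Rightarrow> nat \<Rightarrow> real \<Rightarrow> bool" where
  "first_moment_close p k n \<omega> l B \<longleftrightarrow>
     (\<exists>!x. is_first_moment (p_pot p n \<omega>) k (n_pos n \<omega>) (real l / real k) x) \<and>
     \<bar>phi p k n \<omega> l
        - ereal (real (n_pos n \<omega>)
            * first_moment (p_pot p n \<omega>) k (n_pos n \<omega>) (real l / real k))\<bar> \<le> ereal B"


section \<open>Overlap Gap Property\<close>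

definition OGP :: "nat \<Rightarrow> nat \<Rightarrow> nat \<Rightarrow> outcome \<Rightarrow> nat \<Rightarrow> nat \<Rightarrow> real \<Rightarrow> bool" where
  "OGP p k n \<omega> \<zeta> W H\<^sub>0 \<longleftrightarrow>
     W < k \<and> k\<^sup>2 div p_pot p n \<omega> \<le> \<zeta> \<and> \<zeta> + W + 1 \<le> k \<and> 0 < H\<^sub>0 \<and>
     (\<exists>r::real.
        (\<forall>\<theta>\<in>sparse_vecs p k n \<omega>. real (H p n \<omega> \<theta>) \<le> r \<longrightarrow>
            overlap p n \<omega> \<theta> \<le> \<zeta> \<or> overlap p n \<omega> \<theta> \<ge> \<zeta> + W + 1) \<and>
        (\<exists>\<theta>\<^sub>1\<in>sparse_vecs p k n \<omega>. \<exists>\<theta>\<^sub>2\<in>sparse_vecs p k n \<omega>.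
            overlap p n \<omega> \<theta>\<^sub>1 \<le> \<zeta> \<and> overlap p n \<omega> \<theta>\<^sub>2 \<ge> \<zeta> + W + 1 \<and>
            real (max (H p n \<omega> \<theta>\<^sub>1) (H p n \<omega> \<theta>\<^sub>2)) \<le> r) \<and>
        (SUP \<theta> \<in> {\<theta> \<in> sparse_vecs p k n \<omega>.
                   int \<zeta> + 1 \<le> int (overlap p n \<omega> \<theta>) \<and>
                   int (overlap p n \<omega> \<theta>) \<le> int \<zeta> + int W - 1}.
            ereal (real (H p n \<omega> \<theta>))) \<ge> ereal (r + H\<^sub>0))"

end

theory Submission
  imports Defs
begin

text \<open>
  Write \<open>m\<close> for the number of positive tests, \<open>X = p' - k\<close>, \<open>u = (1 - \<lambda>) ln 2\<close> and
  \<open>b = k ln (X/k) / (m ln 2)\<close>. By two applications of Chebyshev's inequality, a.a.s. \<open>b\<close> lies in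
  \<open>[R - 1/2, R]\<close> (its limit is \<open>2R - 1\<close>). The equation defining \<open>F\<close> is
  \<open>\<alpha>(F, 1 - exp (-u)) = \<rho>\<close> with \<open>\<rho> \<approx> b u\<close>, and \<open>u \<mapsto> \<alpha>(x, 1 - exp (-u))\<close> is convex with a zero at
  \<open>u\<^sub>0 = -ln (1 - x) > 0\<close>, so at \<open>x = F\<close> its slope is at least \<open>\<rho> / (u - u\<^sub>0)\<close>. This exceeds the slope
  \<open>b\<close> of the right-hand side by a constant factor, because \<open>b \<le> R < 1\<close> keeps \<open>F\<close>, and hence \<open>u\<^sub>0\<close>, away
  from \<open>0\<close>. So \<open>F\<close> strictly decreases in \<open>\<lambda>\<close>, and each step in \<open>l\<close> lowers \<open>m F(l/k)\<close> by at least a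
  constant times \<open>ln (p/k)\<close>, which is of order at least \<open>ln k\<close>. Over \<open>w\<^sub>p\<close> steps this beats the error
  \<open>C ln k\<close>, so \<open>\<phi>\<close> takes inside the gap a value smaller than all of its values before it, contradicting
  (1) and (2) of the OGP.
\<close>

section \<open>Convexity of the relative entropy\<close>

text \<open>At \<open>x = 0\<close> the entropy equals \<open>u\<close>, and for small
  \<open>x\<close> the loss is governed by \<open>x * ln x\<close>, hence by \<open>sqrt x\<close>.
  Read backwards: if \<open>alpha\<close> is at most a fixed fraction of \<open>u\<close>, then
  \<open>x\<close> is bounded away from \<open>0\<close>.\<close>

lemma alpha_ge_of_small:
  assumes "0 < u" "u \<le> 1" "0 \<le> x" "x \<le> 1 - exp (- u)"
  shows "alpha x (1 - exp (- u)) \<ge> u - 4 * sqrt x"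
proof (cases "x = 0")
  case True
  then show ?thesis by (simp add: alpha_def ln_div)
next
  case False
  with assms have x: "0 < x" by simp
  have "exp (- u) > 0" by simp
  with assms have x1: "x < 1" by linarith
  define y where "y = 1 - exp (- u)"
  have y: "0 < y" "y < 1" using assms by (simp_all add: y_def)
  have eq: "alpha x y = x * ln x + (1 - x) * ln (1 - x) - x * ln y + (1 - x) * u"
  proof -
    have "ln (1 - y) = - u" by (simp add: y_def)
    then show ?thesis using x x1 y
      by (simp add: alpha_def ln_div algebra_simps)
  qed
  have "- ln (1 - x) = ln (1 / (1 - x))" using x1 by (simp add: ln_div)
  also have "\<dots> \<le> 1 / (1 - x) - 1" using x1 by (intro ln_le_minus_one) auto
  finally have "- ln (1 - x) * (1 - x) \<le> (1 / (1 - x) - 1) * (1 - x)"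
    using x1 by (intro mult_right_mono) auto
  also have "\<dots> = x" using x1 by (simp add: field_simps)
  finally have 1: "(1 - x) * ln (1 - x) \<ge> - x" by (simp add: algebra_simps)
  \<comment> \<open>As \<open>- ln x = 2 * ln (1 / sqrt x)\<close>, the bound
    \<open>ln t \<le> t - 1\<close> yields order \<open>sqrt x\<close>.\<close>
  have "ln (1 / sqrt x) \<le> 1 / sqrt x - 1" using x by (intro ln_le_minus_one) auto
  then have "x * (- ln x) \<le> x * (2 / sqrt x - 2)"
    using x by (intro mult_left_mono) (auto simp: ln_div ln_sqrt)
  also have "\<dots> = 2 * sqrt x - 2 * x"
    using x by (simp add: field_simps)
  finally have 2: "x * ln x \<ge> 2 * x - 2 * sqrt x" by simp
  have 3: "x * ln y \<le> 0" using x y by (simp add: mult_nonneg_nonpos)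
  have 4: "x * u \<le> x" using assms x by (simp add: mult_left_le)
  have 5: "sqrt x \<ge> 0" using x by simp
  have "alpha x y \<ge> u - 4 * sqrt x"
  proof -
    have "(1 - x) * u = u - x * u" by (simp add: algebra_simps)
    then show ?thesis using 1 2 3 4 5 x unfolding eq by linarith
  qed
  then show ?thesis by (simp add: y_def)
qed

text \<open>The derivative in the first argument is the difference of the log-odds of
  \<open>x\<close> and \<open>y\<close>, which on \<open>[a, y]\<close> lies between
  \<open>- 1 / a\<close> and \<open>0\<close>. The mean value theorem gives both bounds.\<close>

lemma alpha_Lipschitz:
  assumes "0 < a" "a \<le> x" "x \<le> x'" "x' \<le> y" "y \<le> 1 / 2"
  shows "alpha x y \<ge> alpha x' y" "alpha x y - alpha x' y \<le> (x' - x) / a"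
proof -
  have "alpha x y \<ge> alpha x' y \<and> alpha x y - alpha x' y \<le> (x' - x) / a"
  proof (cases "x = x'")
    case False
    with assms have xx: "x < x'" by simp
    have deriv: "((\<lambda>x. alpha x y) has_real_derivative (ln z - ln (1 - z) - ln y + ln (1 - y))) (at z)"
      if z: "x \<le> z" "z \<le> x'" for z
    proof -
      have pos: "0 < z" "z < 1" "0 < y" "y < 1" using assms z by auto
      have "((\<lambda>x. x * (ln x - ln y) + (1 - x) * (ln (1 - x) - ln (1 - y))) has_real_derivative
          (ln z - ln (1 - z) - ln y + ln (1 - y))) (at z)"
        using pos by (auto intro!: derivative_eq_intros)
      moreover have "eventually (\<lambda>x. x \<in> {0<..<1}) (nhds z)"
        using pos by (intro eventually_nhds_in_open) auto
      then have ev: "eventually (\<lambda>x. alpha x y = x * (ln x - ln y) + (1 - x) * (ln (1 - x) - ln (1 - y))) (nhds z)"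
        by eventually_elim (use pos in \<open>simp add: alpha_def ln_div\<close>)
      ultimately show ?thesis
        using DERIV_cong_ev[OF refl ev refl] by simp
    qed
    obtain z where z: "x < z" "z < x'"
        "alpha x' y - alpha x y = (x' - x) * (ln z - ln (1 - z) - ln y + ln (1 - y))"
      using MVT2[OF xx deriv] by auto
    define d where "d = ln y + ln (1 - z) - ln z - ln (1 - y)"
    have "ln z \<le> ln y" "ln (1 - y) \<le> ln (1 - z)" "ln y \<le> ln (1 - y)" "ln (1 - z) \<le> 0"
      "- ln z \<le> - ln a"
      using z assms by auto
    moreover have "- ln a \<le> 1 / a"
      using ln_le_minus_one[of "1/a"] assms by (simp add: ln_div)
    ultimately have d: "0 \<le> d" "d \<le> 1 / a" by (auto simp: d_def)
    have "alpha x y - alpha x' y = (x' - x) * d" using z(3) by (simp add: d_def algebra_simps)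
    moreover have "(x' - x) * d \<le> (x' - x) * (1 / a)" using d xx by (intro mult_left_mono) auto
    moreover have "(x' - x) * d \<ge> 0" using d xx by simp
    ultimately show ?thesis by simp
  qed auto
  then show "alpha x y \<ge> alpha x' y" "alpha x y - alpha x' y \<le> (x' - x) / a" by auto
qed

text \<open>
  For fixed \<open>x\<close> the function \<open>u \<mapsto> \<alpha>(x, 1 - e\<^sup>-\<^sup>u)\<close> is convex and vanishes at
  \<open>u\<^sub>0 = -ln (1 - x)\<close>; compare its chords over \<open>[u\<^sub>0, u]\<close> and \<open>[u, u']\<close>.
\<close>
lemma alpha_chord:
  assumes "0 < x" "x < 1 - exp (- u)" "u < u'"
  shows "(alpha x (1 - exp (- u')) - alpha x (1 - exp (- u))) * (u + ln (1 - x))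
           \<ge> (u' - u) * alpha x (1 - exp (- u))"
proof -
  define f where "f = (\<lambda>u. alpha x (1 - exp (- u)))"
  define f' where "f' = (\<lambda>u. (1 - x) - x / (exp u - 1))"
  define u0 where "u0 = - ln (1 - x)"
  have "exp (- u) > 0" by simp
  with assms have x1: "x < 1" by linarith
  have u0: "0 < u0" using assms x1 by (simp add: u0_def)
  have "exp (- u) < exp (- u0)" using assms x1 by (simp add: u0_def)
  then have u0u: "u0 < u" by simp
  have f0: "f u0 = 0" using x1 assms by (simp add: f_def u0_def alpha_def)
  have deriv: "(f has_real_derivative f' v) (at v)" if "u0 \<le> v" for v
  proof -
    have v: "v > 0" using that u0 by simp
    have "((\<lambda>v. x * (ln x - ln (1 - exp (- v))) + (1 - x) * (ln (1 - x) + v))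
        has_real_derivative f' v) (at v)"
      using v by (auto intro!: derivative_eq_intros simp: f'_def field_simps exp_minus)
    moreover have "eventually (\<lambda>v. v \<in> {0<..}) (nhds v)"
      using v by (intro eventually_nhds_in_open) auto
    then have ev: "eventually (\<lambda>v. f v = x * (ln x - ln (1 - exp (- v))) + (1 - x) * (ln (1 - x) + v)) (nhds v)"
      by eventually_elim (use assms x1 in \<open>simp add: f_def alpha_def ln_div\<close>)
    ultimately show ?thesis
      using DERIV_cong_ev[OF refl ev refl] by simp
  qed
  obtain v where v: "u0 < v" "v < u" "f u - f u0 = (u - u0) * f' v"
    using MVT2[OF u0u deriv] by auto
  obtain v' where v': "u < v'" "v' < u'" "f u' - f u = (u' - u) * f' v'"
    using MVT2[OF assms(3) deriv] u0u by auto
  \<comment> \<open>This is the convexity: \<open>f'\<close> increases because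
    \<open>exp v - 1\<close> does.\<close>
  have "f' v \<le> f' v'"
    using v v' u0 assms unfolding f'_def by (intro diff_left_mono divide_left_mono) auto
  then have "(u' - u) * (u - u0) * f' v \<le> (u' - u) * (u - u0) * f' v'"
    using assms u0u by (intro mult_left_mono) auto
  then have "(u' - u) * (f u - f u0) \<le> (u - u0) * (f u' - f u)"
    unfolding v v' by (simp add: mult_ac)
  then show ?thesis
    by (simp add: f0) (simp add: f_def u0_def mult_ac)
qed

text \<open>The number \<open>a\<close> is a lower bound for \<open>x\<close> and \<open>x'\<close>, coming from \<open>alpha_ge_of_small\<close>.\<close>
lemma first_moment_gap:
  assumes u: "umin \<le> u" "u < u'" "u' \<le> ln 2" and umin: "0 < umin"
    and b: "0 < blo" "blo \<le> b" and bhi: "bhi < 1"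
    and x: "x \<in> {0..1 - exp (- u)}" and x': "x' \<in> {0..1 - exp (- u')}"
    and upper: "alpha x (1 - exp (- u)) \<le> bhi * u" "alpha x' (1 - exp (- u')) \<le> bhi * u'"
    and lower: "alpha x (1 - exp (- u)) \<ge> b * u"
    and diff: "alpha x' (1 - exp (- u')) - alpha x (1 - exp (- u)) \<le> (b + \<tau>) * (u' - u)"
    and a_def: "a = ((1 - bhi) * umin / 4)\<^sup>2"
    and tau: "\<tau> \<le> blo * a / 2"
  shows "x' - x \<ge> blo * a\<^sup>2 / 2 * (u' - u)"
proof -
  have ln2: "ln 2 < (1::real)" using ln_2_less_1 .
  have a: "a > 0" using a_def bhi umin by simp
  \<comment> \<open>If \<open>alpha\<close> is at most \<open>bhi * v\<close>, the remaining
    \<open>(1 - bhi) * v\<close> is at most \<open>4 * sqrt z\<close>.\<close>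
  have lb: "a \<le> z" if "alpha z (1 - exp (- v)) \<le> bhi * v" "umin \<le> v" "v \<le> ln 2"
    "z \<in> {0..1 - exp (- v)}" for z v
  proof -
    have "v - 4 * sqrt z \<le> bhi * v"
      using alpha_ge_of_small[of v z] that umin ln2 by auto
    then have "(1 - bhi) * v \<le> 4 * sqrt z" by (simp add: algebra_simps)
    moreover have "(1 - bhi) * umin \<le> (1 - bhi) * v" using that bhi by (intro mult_left_mono) auto
    ultimately have "(1 - bhi) * umin / 4 \<le> sqrt z" by simp
    then have "((1 - bhi) * umin / 4)\<^sup>2 \<le> (sqrt z)\<^sup>2"
      using bhi umin by (intro power_mono) auto
    then show "a \<le> z" using that by (simp add: a_def)
  qed
  have ax: "a \<le> x" using lb[OF upper(1)] u x by auto
  have ax': "a \<le> x'" using lb[OF upper(2)] u x' by auto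
  have u0: "0 < u" using u umin by simp
  define y where "y = 1 - exp (- u)"
  define y' where "y' = 1 - exp (- u')"
  have yy: "y \<le> y'" using u by (simp add: y_def y'_def)
  have "exp (- u') \<ge> exp (- ln 2)" using u by simp
  then have y'2: "y' \<le> 1 / 2" by (simp add: y'_def exp_minus)
  have bu: "b * u > 0" using b u0 by simp
  have "x \<noteq> y"
  proof
    assume "x = y"
    then have "alpha x y = 0" using ax a yy y'2 by (simp add: alpha_def)
    with lower bu show False by (simp add: y_def)
  qed
  then have xy: "x < y" using x by (simp add: y_def)
  have "exp (- u) > 0" by simp
  then have x1: "x < 1" using xy y_def by linarith
  have "exp (- u) < 1 - x" using xy by (simp add: y_def)
  then have "ln (exp (- u)) < ln (1 - x)" using x1 by (subst ln_less_cancel_iff) auto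
  then have upos: "u + ln (1 - x) > 0" by simp
  \<comment> \<open>Here \<open>u + ln (1 - x)\<close> is the chord length \<open>u - u0\<close>
    with \<open>u0 = - ln (1 - x)\<close>, and \<open>u0 \<ge> x \<ge> a\<close>.\<close>
  have "ln (1 - x) \<le> - x" using ln_le_minus_one[of "1 - x"] x1 by simp
  then have up: "u + ln (1 - x) \<le> u - a" using ax by linarith
  have "(u' - u) * (b * u) \<le> (u' - u) * alpha x y"
    using lower u by (intro mult_left_mono) (auto simp: y_def)
  also have "\<dots> \<le> (alpha x y' - alpha x y) * (u + ln (1 - x))"
    unfolding y_def y'_def using alpha_chord[of x u u'] xy ax a u by (simp add: y_def)
  finally have c1: "(u' - u) * (b * u) \<le> (alpha x y' - alpha x y) * (u + ln (1 - x))" .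
  have Dpos: "0 \<le> alpha x y' - alpha x y"
  proof (rule ccontr)
    assume "\<not> ?thesis"
    then have "(alpha x y' - alpha x y) * (u + ln (1 - x)) < 0"
      using upos by (simp add: mult_neg_pos)
    moreover have "(u' - u) * (b * u) > 0" using u bu by simp
    ultimately show False using c1 by linarith
  qed
  have "(u' - u) * (b * u) \<le> (alpha x y' - alpha x y) * (u - a)"
    using c1 mult_left_mono[OF up Dpos] by linarith
  \<comment> \<open>The chord slope \<open>b * u / (u - a)\<close> is at least
    \<open>b * (1 + a)\<close>, since \<open>u \<le> 1\<close>.\<close>
  moreover have "b * (u' - u) * ((1 + a) * (u - a)) \<le> b * (u' - u) * u"
  proof (rule mult_left_mono)
    have "a * u \<le> a" using a u ln2 by (simp add: mult_left_le)
    moreover have "a * a \<ge> 0" by simp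
    moreover have "(1 + a) * (u - a) = u + (a * u - a) - a * a" by (simp add: algebra_simps)
    ultimately show "(1 + a) * (u - a) \<le> u" by linarith
  qed (use b u in auto)
  ultimately have "(b * (u' - u) * (1 + a)) * (u - a) \<le> (alpha x y' - alpha x y) * (u - a)"
    by (simp add: mult_ac)
  then have "b * (u' - u) * (1 + a) \<le> alpha x y' - alpha x y"
    using up upos by (simp add: mult_le_cancel_right)
  moreover have "alpha x' y' - alpha x y \<le> (b + \<tau>) * (u' - u)"
    using diff by (simp add: y_def y'_def)
  \<comment> \<open>With \<open>x\<close> kept fixed the entropy would grow by at least
    \<open>b * (1 + a)\<close> per unit of \<open>u\<close>, but it may grow only by
    \<open>b + \<tau>\<close>; the excess has to be removed by moving from \<open>x\<close> to
    \<open>x'\<close>.\<close>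
  ultimately have "(b * a - \<tau>) * (u' - u) \<le> alpha x y' - alpha x' y'"
    by (simp add: algebra_simps)
  moreover have "blo * a / 2 * (u' - u) \<le> (b * a - \<tau>) * (u' - u)"
  proof (rule mult_right_mono)
    have "blo * a \<le> b * a" using b a by simp
    then show "blo * a / 2 \<le> b * a - \<tau>" using tau by linarith
  qed (use u in auto)
  ultimately have main: "blo * a / 2 * (u' - u) \<le> alpha x y' - alpha x' y'" by linarith
  have mpos: "blo * a / 2 * (u' - u) > 0" using b a u by simp
  have "x \<le> x'"
  proof (rule ccontr)
    assume "\<not> ?thesis"
    then have "alpha x' y' \<ge> alpha x y'"
      using alpha_Lipschitz(1)[of a x' x y'] ax' a xy yy y'2 by auto
    then show False using main mpos by linarith
  qed
  then have "alpha x y' - alpha x' y' \<le> (x' - x) / a"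
    using alpha_Lipschitz(2)[of a x x' y'] ax a x' y'2 by (auto simp: y'_def)
  then have "blo * a / 2 * (u' - u) \<le> (x' - x) / a" using main by linarith
  then have "blo * a / 2 * (u' - u) * a \<le> x' - x" using a by (simp add: pos_le_divide_eq)
  then show ?thesis by (simp add: power2_eq_square mult_ac)
qed

section \<open>Monotonicity of the first moment function\<close>

lemma ln_binomial_le:
  assumes "0 < j" "j \<le> N"
  shows "ln (real (N choose j)) \<le> real j * (ln (real N / real j) + 1)"
proof -
  define t where "t = real j / real N"
  have t: "0 < t" using assms by (simp add: t_def)
  \<comment> \<open>One term of the binomial expansion of \<open>(t + 1) ^ N\<close>, which is at
    most \<open>exp (t * N) = exp j\<close>.\<close>
  have "real (N choose j) * t ^ j * 1 ^ (N - j) \<le> (\<Sum>i\<le>N. real (N choose i) * t ^ i * 1 ^ (N - i))"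
    by (rule member_le_sum) (use assms t in auto)
  also have "\<dots> = (t + 1) ^ N" by (simp add: binomial_ring)
  also have "\<dots> \<le> exp t ^ N" using t exp_ge_add_one_self[of t] by (intro power_mono) (auto simp: add.commute)
  also have "\<dots> = exp (real j)" using assms by (simp add: t_def flip: exp_of_nat_mult)
  finally have "ln (real (N choose j) * t ^ j) \<le> ln (exp (real j))"
    using t assms by (subst ln_le_cancel_iff) auto
  moreover have "ln (real (N choose j) * t ^ j) = ln (real (N choose j)) + real j * ln t"
    using t assms by (simp add: ln_mult ln_realpow)
  moreover have "ln (real N / real j) = - ln t" using assms by (simp add: t_def ln_div)
  ultimately show ?thesis by (simp add: algebra_simps)
qed

lemma ln_binomial_ge:
  assumes "0 < j" "j \<le> N"
  shows "real j * ln (real N / real j) \<le> ln (real (N choose j))"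
proof -
  have "(real N / real j) ^ j \<le> real (N choose j)"
    using binomial_ge_n_over_k_pow_k[OF assms(2), where 'a=real] by simp
  then have "ln ((real N / real j) ^ j) \<le> ln (real (N choose j))"
    using assms by (subst ln_le_cancel_iff) auto
  then show ?thesis using assms by (simp add: ln_realpow)
qed

lemma Suc_times_choose_Suc: "Suc k * (n choose Suc k) = (n - k) * (n choose k)"
  by (simp only: binomial_absorption binomial_absorb_comp)

text \<open>The number of \<open>k\<close>-sparse vectors with overlap \<open>l\<close> when
  \<open>X\<close> potentially defective items are nondefective. With \<open>X = q - k\<close> it is
  the \<open>N\<close> of \<open>is_first_moment\<close> at \<open>t = l / k\<close>.\<close>

definition overlap_count :: "nat \<Rightarrow> nat \<Rightarrow> nat \<Rightarrow> nat" where
  "overlap_count X k l = (k choose l) * (X choose (k - l))"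

text \<open>With \<open>d = k - l\<close> and \<open>i = d - 1\<close>, the counts at
  \<open>l\<close> and \<open>l + 1\<close> differ by the factor
  \<open>(l + 1) * (X - i) / d^2\<close>. Since \<open>l + 1 \<le> k\<close> and
  \<open>d \<ge> h * k\<close>, this is at most a constant times \<open>X / k\<close>.\<close>

lemma overlap_count_step:
  assumes h: "0 < h" and l: "real l + h * real k \<le> real k" "0 < k"
  shows "real (overlap_count X k l) \<le> real (overlap_count X k (Suc l)) * (real X / (h\<^sup>2 * real k))"
proof -
  have "0 < h * real k" using h l by simp
  then have "l < k" using l by linarith
  then obtain i where i: "k - l = Suc i" "k - Suc l = i"
    by (metis Suc_diff_Suc)
  define d where "d = real (Suc i)"
  have d: "d = real (k - l)" "d \<ge> h * real k" "0 < d"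
    using i \<open>l < k\<close> l by (auto simp: d_def of_nat_diff)
  have "real (Suc l) * real (k choose Suc l) = d * real (k choose l)"
    unfolding d(1) of_nat_mult[symmetric] Suc_times_choose_Suc ..
  moreover have "d * real (X choose Suc i) = real (X - i) * real (X choose i)"
    unfolding d_def of_nat_mult[symmetric] Suc_times_choose_Suc ..
  ultimately have "(d * real (k choose l)) * (d * real (X choose Suc i))
      = (real (Suc l) * real (k choose Suc l)) * (real (X - i) * real (X choose i))"
    by simp
  then have "d\<^sup>2 * real (overlap_count X k l)
      = real (Suc l) * real (X - i) * real (overlap_count X k (Suc l))"
    unfolding overlap_count_def i power2_eq_square by (simp only: of_nat_mult mult_ac)
  also have "\<dots> \<le> real k * real X * real (overlap_count X k (Suc l))"
    by (intro mult_right_mono mult_mono) (use \<open>l < k\<close> in auto)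
  finally have "d\<^sup>2 * real (overlap_count X k l) \<le> real k * real X * real (overlap_count X k (Suc l))" .
  moreover have "(h * real k)\<^sup>2 \<le> d\<^sup>2" using d h by (intro power_mono) auto
  then have "(h * real k)\<^sup>2 * real (overlap_count X k l) \<le> d\<^sup>2 * real (overlap_count X k l)"
    by (intro mult_right_mono) auto
  ultimately have "(h * real k)\<^sup>2 * real (overlap_count X k l)
      \<le> real k * real X * real (overlap_count X k (Suc l))" by linarith
  then show ?thesis using h l by (simp add: field_simps power2_eq_square)
qed

lemma overlap_count_chain:
  assumes h: "0 < h" and l: "real (l + i) + h * real k \<le> real k" "0 < k"
  shows "real (overlap_count X k l) \<le> real (overlap_count X k (l + i)) * (real X / (h\<^sup>2 * real k)) ^ i"
  using l(1)
proof (induction i)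
  case (Suc i)
  have "real (overlap_count X k l) \<le> real (overlap_count X k (l + i)) * (real X / (h\<^sup>2 * real k)) ^ i"
    using Suc by simp
  also have "\<dots> \<le> (real (overlap_count X k (Suc (l + i))) * (real X / (h\<^sup>2 * real k)))
      * (real X / (h\<^sup>2 * real k)) ^ i"
    using Suc.prems h l by (intro mult_right_mono overlap_count_step) auto
  finally show ?case by (simp add: mult_ac)
qed simp

text \<open>For \<open>t = l / k\<close> both floors are exact, and in the variable \<open>u\<close>
  the second argument of \<open>alpha\<close> is \<open>1 - exp (- u)\<close>, the form used by the
  convexity estimates.\<close>

lemma is_first_moment_overlap:
  assumes "is_first_moment q k m (real l / real k) x" "l \<le> k" "0 < k"
  defines "u \<equiv> (1 - real l / real k) * ln 2"
  shows "0 < m" "0 < overlap_count (q - k) k l" "x \<in> {0..1 - exp (- u)}"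
    "alpha x (1 - exp (- u)) = ln (real (overlap_count (q - k) k l)) / real m"
proof -
  have 1: "nat \<lfloor>real l / real k * real k\<rfloor> = l" using assms by simp
  have "(1 - real l / real k) * real k = real (k - l)"
    using assms by (simp add: of_nat_diff field_simps)
  then have 2: "nat \<lfloor>(1 - real l / real k) * real k\<rfloor> = k - l" by simp
  have 3: "2 powr (real l / real k - 1) = exp (- u)"
    by (simp add: powr_def u_def algebra_simps)
  show "0 < m" "0 < overlap_count (q - k) k l" "x \<in> {0..1 - exp (- u)}"
    "alpha x (1 - exp (- u)) = ln (real (overlap_count (q - k) k l)) / real m"
    using assms(1) unfolding is_first_moment_def 1 2 3 Let_def overlap_count_def by auto
qed

text \<open>The main term comes from \<open>X choose (k - l)\<close>. The factor
  \<open>k choose l\<close>, at most \<open>2 ^ k\<close>, costs only a constant per unit of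
  \<open>k - l\<close>, because \<open>k - l \<ge> h * k\<close>.\<close>

lemma ln_overlap_count_bounds:
  assumes h: "0 < h" "h \<le> 1" and l: "real l + h * real k \<le> real k" "0 < k" "k \<le> X"
  defines "g \<equiv> ln (real X / real k)"
  shows "real (k - l) * g \<le> ln (real (overlap_count X k l))"
    "ln (real (overlap_count X k l)) \<le> real (k - l) * (g + (ln 2 / h + ln (1 / h) + 1))"
proof -
  have "0 < h * real k" using h l by simp
  then have "l < k" using l by linarith
  define j where "j = k - l"
  have j: "0 < j" "j \<le> k" "j \<le> X" "real j \<ge> h * real k" "real j = real k - real l"
    using \<open>l < k\<close> l by (auto simp: j_def of_nat_diff)
  have pos: "0 < X choose j" "0 < k choose l"
    using zero_less_binomial[OF j(3)] zero_less_binomial[OF less_imp_le[OF \<open>l < k\<close>]] .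
  have eq: "ln (real (overlap_count X k l)) = ln (real (k choose l)) + ln (real (X choose j))"
    using pos by (simp add: overlap_count_def ln_mult flip: j_def)
  have "g \<le> ln (real X / real j)"
    unfolding g_def using j l by (subst ln_le_cancel_iff) (auto simp: divide_simps)
  then have "real j * g \<le> real j * ln (real X / real j)" by (rule mult_left_mono) simp
  also have "\<dots> \<le> ln (real (X choose j))" using j by (intro ln_binomial_ge) auto
  also have "\<dots> \<le> ln (real (overlap_count X k l))"
  proof -
    have "1 \<le> real (k choose l)" using pos(2) unfolding real_of_nat_ge_one_iff by linarith
    then show ?thesis by (simp add: eq)
  qed
  finally show "real (k - l) * g \<le> ln (real (overlap_count X k l))" by (simp add: j_def)
  have "ln (real X / real j) \<le> ln (real X / (h * real k))"
    using j l h by (subst ln_le_cancel_iff) (auto simp: divide_simps)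
  also have "\<dots> = g + ln (1 / h)" using h l by (simp add: g_def ln_mult ln_div)
  finally have 1: "ln (real X / real j) \<le> g + ln (1 / h)" .
  have "ln (real (X choose j)) \<le> real j * (ln (real X / real j) + 1)"
    using j by (intro ln_binomial_le) auto
  also have "\<dots> \<le> real j * (g + ln (1 / h) + 1)" using 1 by (intro mult_left_mono) auto
  finally have 2: "ln (real (X choose j)) \<le> real j * (g + ln (1 / h) + 1)" .
  have "real (k choose l) \<le> 2 ^ k" using of_nat_mono[OF binomial_le_pow2[of k l], where 'a=real] by simp
  then have "ln (real (k choose l)) \<le> ln (2 ^ k)" using pos by (subst ln_le_cancel_iff) auto
  also have "\<dots> = real k * ln 2" by (simp add: ln_realpow)
  also have "\<dots> \<le> (real j / h) * ln 2" using j h by (intro mult_right_mono) (auto simp: field_simps)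
  finally have "ln (real (k choose l)) \<le> real j * (ln 2 / h)" by simp
  with 2 have "ln (real (overlap_count X k l)) \<le> real j * (g + (ln 2 / h + ln (1 / h) + 1))"
    unfolding eq by (simp add: distrib_left)
  then show "ln (real (overlap_count X k l)) \<le> real (k - l) * (g + (ln 2 / h + ln (1 / h) + 1))"
    by (simp add: j_def)
qed

text \<open>This is \<open>first_moment_gap\<close> with the binomial errors controlled: by
  \<open>m1\<close> and \<open>m2\<close> they are small against \<open>m\<close>. The first is
  absorbed by relaxing the upper slope \<open>bhi\<close> to \<open>(1 + bhi) / 2\<close>, still
  below \<open>1\<close>; the second gives the bound on \<open>\<tau>\<close>.\<close>

lemma first_moment_decrease:
  fixes k q m l l' :: nat
  assumes fm: "is_first_moment q k m (real l / real k) x" "is_first_moment q k m (real l' / real k) x'"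
    and l: "l < l'" "real l' + h * real k \<le> real k" and k: "0 < k" "k \<le> q - k"
    and h: "0 < h" "h \<le> 1"
    and b: "0 < blo" "bhi < 1"
    and g0: "blo * (real m * ln 2) \<le> real k * ln (real (q - k) / real k)"
    and g1: "real k * ln (real (q - k) / real k) \<le> bhi * (real m * ln 2)"
    and a_def: "a = ((1 - bhi) / 2 * (h * ln 2) / 4)\<^sup>2"
    and m1: "real k * (ln 2 / h + ln (1 / h) + 1) \<le> (1 - bhi) / 2 * (real m * ln 2)"
    and m2: "real k * (2 * ln (1 / h)) \<le> blo * a / 2 * (real m * ln 2)"
  shows "x - x' \<ge> blo * a\<^sup>2 / 2 * ln 2 * (real (l' - l) / real k)"
proof -
  define X where "X = q - k"
  define g where "g = ln (real X / real k)"
  define u where "u i = (1 - real i / real k) * ln 2" for i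
  define M where "M = real m * ln 2"
  have "0 < h * real k" using h k by simp
  then have lk: "l' < k" "l < k" "real l + h * real k \<le> real k" using l by linarith+
  note F = is_first_moment_overlap[OF fm(1) less_imp_le[OF lk(2)] k(1), folded u_def X_def]
  note F' = is_first_moment_overlap[OF fm(2) less_imp_le[OF lk(1)] k(1), folded u_def X_def]
  have M: "M > 0" using F(1) by (simp add: M_def)
  have X: "k \<le> X" using k by (simp add: X_def)
  \<comment> \<open>The quantity \<open>(k - i) / m\<close> is proportional to \<open>u i\<close>,
    and the factor turns \<open>g\<close> into the slope \<open>k * g / M\<close>.\<close>
  have rho_u: "real (k - i) / real m = u i * (real k / M)" if "i < k" for i
    using that F(1) k by (simp add: u_def M_def of_nat_diff field_simps)
  have lower: "(real k * g / M) * u i \<le> ln (real (overlap_count X k i)) / real m"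
    and upper: "ln (real (overlap_count X k i)) / real m \<le> (1 + bhi) / 2 * u i"
    if i: "real i + h * real k \<le> real k" "i < k" for i
  proof -
    have u0: "0 \<le> u i" using i by (simp add: u_def)
    note B = ln_overlap_count_bounds[OF h i(1) k(1) X, folded g_def]
    have "(real k * g / M) * u i = real (k - i) / real m * g"
      unfolding rho_u[OF i(2)] by simp
    also have "\<dots> \<le> ln (real (overlap_count X k i)) / real m"
      using divide_right_mono[OF B(1), of "real m"] by simp
    finally show "(real k * g / M) * u i \<le> ln (real (overlap_count X k i)) / real m" .
    have "ln (real (overlap_count X k i)) / real m \<le> (real (k - i) / real m) * (g + (ln 2 / h + ln (1 / h) + 1))"
      using divide_right_mono[OF B(2), of "real m"] by simp
    also have "\<dots> = u i * ((real k * g + real k * (ln 2 / h + ln (1 / h) + 1)) / M)"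
      unfolding rho_u[OF i(2)] distrib_left[of "real k", symmetric] by simp
    also have "\<dots> \<le> u i * ((1 + bhi) / 2)"
    proof (rule mult_left_mono)
      have "real k * g + real k * (ln 2 / h + ln (1 / h) + 1) \<le> bhi * M + (1 - bhi) / 2 * M"
        using g1 m1 by (intro add_mono) (auto simp: g_def X_def M_def)
      also have "\<dots> = (1 + bhi) / 2 * M" by (simp add: field_simps)
      finally show "(real k * g + real k * (ln 2 / h + ln (1 / h) + 1)) / M \<le> (1 + bhi) / 2"
        using M by (simp add: pos_divide_le_eq)
    qed (rule u0)
    finally show "ln (real (overlap_count X k i)) / real m \<le> (1 + bhi) / 2 * u i" by (simp add: mult.commute)
  qed
  have du: "u l - u l' = real (l' - l) / real k * ln 2"
    using l k by (simp add: u_def of_nat_diff field_simps)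
  \<comment> \<open>Ratios of consecutive counts are used here: subtracting the two-sided bounds
    would leave an error of order \<open>k - l\<close> instead of \<open>l' - l\<close>.\<close>
  have diff: "ln (real (overlap_count X k l)) / real m - ln (real (overlap_count X k l')) / real m
      \<le> (real k * g / M + real k * (2 * ln (1 / h)) / M) * (u l - u l')"
  proof -
    have Xk: "0 < real X / (h\<^sup>2 * real k)" using X k h by auto
    have "real (overlap_count X k l) \<le> real (overlap_count X k l') * (real X / (h\<^sup>2 * real k)) ^ (l' - l)"
      using overlap_count_chain[OF h(1), of l "l' - l" k X] l k by simp
    then have "ln (real (overlap_count X k l)) \<le> ln (real (overlap_count X k l') * (real X / (h\<^sup>2 * real k)) ^ (l' - l))"
      using F F' Xk k by (subst ln_le_cancel_iff) auto
    also have "\<dots> = ln (real (overlap_count X k l')) + real (l' - l) * ln (real X / (h\<^sup>2 * real k))"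
      using F'(2) Xk by (subst ln_mult) (simp_all only: ln_realpow, auto)
    also have "ln (real X / (h\<^sup>2 * real k)) = g + 2 * ln (1 / h)"
      using X k h by (simp add: g_def ln_div ln_mult ln_realpow)
    finally have "ln (real (overlap_count X k l)) - ln (real (overlap_count X k l'))
        \<le> real (l' - l) * (g + 2 * ln (1 / h))" by simp
    then have "(ln (real (overlap_count X k l)) - ln (real (overlap_count X k l'))) / real m
        \<le> real (l' - l) * (g + 2 * ln (1 / h)) / real m" by (rule divide_right_mono) simp
    also have "\<dots> = (real k * g / M + real k * (2 * ln (1 / h)) / M) * (u l - u l')"
      unfolding du using k F(1) by (simp add: M_def field_simps)
    finally show ?thesis by (simp add: diff_divide_distrib)
  qed
  have "x - x' \<ge> blo * a\<^sup>2 / 2 * (u l - u l')"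
  \<comment> \<open>As \<open>u\<close> decreases in \<open>l\<close>, the roles are exchanged:
    \<open>l'\<close> supplies the smaller \<open>u\<close>, and \<open>x - x'\<close> is bounded
    from below.\<close>
  proof (rule first_moment_gap[where umin = "h * ln 2" and b = "real k * g / M" and bhi = "(1 + bhi) / 2"
        and \<tau> = "real k * (2 * ln (1 / h)) / M"])
    have "h \<le> 1 - real l' / real k" using l k by (simp add: field_simps)
    then show "h * ln 2 \<le> u l'" unfolding u_def by (rule mult_right_mono) simp
    have "0 < u l - u l'" unfolding du using l k by simp
    then show "u l' < u l" by simp
    show "u l \<le> ln 2" using k by (simp add: u_def)
    show "blo \<le> real k * g / M" using g0 M by (simp add: pos_le_divide_eq g_def X_def M_def)
    show "x' \<in> {0..1 - exp (- u l')}" "x \<in> {0..1 - exp (- u l)}" using F F' by auto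
    show "a = ((1 - (1 + bhi) / 2) * (h * ln 2) / 4)\<^sup>2"
      unfolding a_def by (simp add: field_simps)
    show "real k * (2 * ln (1 / h)) / M \<le> blo * a / 2"
      using m2 M by (simp add: pos_divide_le_eq M_def)
  qed (use F F' lower upper diff l lk b h in auto)
  then show ?thesis unfolding du by (simp add: mult_ac)
qed

section \<open>Concentration of the number of potentially defective items\<close>

text \<open>Conditioning on the first stage: values in \<open>B\<close> are charged with probability
  \<open>1\<close>, all others with at most \<open>e\<close>.\<close>

lemma prob_bind_pmf_le:
  assumes "\<And>x. x \<in> set_pmf M \<Longrightarrow> x \<notin> B \<Longrightarrow> measure_pmf.prob (N x) S \<le> e" "0 \<le> e"
  shows "measure_pmf.prob (bind_pmf M N) S \<le> measure_pmf.prob M B + e"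
proof -
  have "emeasure (bind_pmf M N) S = (\<integral>\<^sup>+x. emeasure (N x) S \<partial>M)" by simp
  also have "\<dots> \<le> (\<integral>\<^sup>+x. indicator B x + ennreal e \<partial>M)"
  proof (intro nn_integral_mono_AE, subst AE_measure_pmf_iff, intro ballI)
    fix x assume x: "x \<in> set_pmf M"
    show "emeasure (N x) S \<le> indicator B x + ennreal e"
    proof (cases "x \<in> B")
      case True
      have "emeasure (N x) S \<le> 1" by (rule measure_pmf.emeasure_le_1)
      then show ?thesis using True by (simp add: add_increasing2)
    next
      case False
      then show ?thesis using assms x by (simp add: measure_pmf.emeasure_eq_measure ennreal_leI)
    qed
  qed
  also have "\<dots> = emeasure M B + ennreal e"
    by (subst nn_integral_add) (auto simp: measure_pmf.emeasure_space_1)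
  also have "\<dots> = ennreal (measure_pmf.prob M B + e)"
    using assms(2) by (simp add: measure_pmf.emeasure_eq_measure ennreal_plus)
  finally show ?thesis
    using assms(2) by (subst (asm) measure_pmf.emeasure_eq_measure, subst (asm) ennreal_le_iff) auto
qed

lemma prob_pair_pmf_le:
  assumes "\<And>x. x \<in> set_pmf M \<Longrightarrow> x \<notin> B \<Longrightarrow> measure_pmf.prob N {y. E (x, y)} \<le> e" "0 \<le> e"
  shows "measure_pmf.prob (pair_pmf M N) {z. E z} \<le> measure_pmf.prob M B + e"
proof -
  have eq: "pair_pmf M N = bind_pmf M (\<lambda>x. map_pmf (Pair x) N)"
    by (simp add: pair_pmf_def map_pmf_def)
  show ?thesis unfolding eq
    by (rule prob_bind_pmf_le) (use assms in \<open>simp_all add: vimage_def\<close>)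
qed

section \<open>Second moment method for blocks of independent coordinates\<close>

lemma prob_Pi_bernoulli_all_False:
  assumes "finite I" "S \<subseteq> I" "0 \<le> \<theta>" "\<theta> \<le> 1"
  shows "measure_pmf.prob (Pi_pmf I False (\<lambda>_. bernoulli_pmf \<theta>)) {A. \<forall>i\<in>S. \<not> A i} = (1 - \<theta>) ^ card S"
proof -
  have eq: "{A. \<forall>i\<in>S. \<not> A i} = Pi I (\<lambda>i. if i \<in> S then {False} else UNIV)"
    using assms(2) by (auto simp: Pi_def split: if_splits)
  have "measure_pmf.prob (Pi_pmf I False (\<lambda>_. bernoulli_pmf \<theta>)) {A. \<forall>i\<in>S. \<not> A i}
      = (\<Prod>i\<in>I. if i \<in> S then 1 - \<theta> else 1)"
    unfolding eq using assms
    by (subst measure_Pi_pmf_Pi) (auto intro!: prod.cong simp: measure_pmf_single)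
  also have "\<dots> = (1 - \<theta>) ^ card S"
    using assms by (simp add: prod.If_cases Int_absorb1)
  finally show ?thesis .
qed

text \<open>Disjoint blocks make the events pairwise independent, so the variance of their number is
  at most its mean, and Chebyshev's inequality applies. The blocks will be the rows of the tests
  over the defective items, and then the columns of the other items over the negative tests.\<close>

lemma Pi_bernoulli_all_False_deviation:
  fixes S :: "'b \<Rightarrow> 'a set"
  assumes I: "finite I" "finite T" and S: "\<And>t. t \<in> T \<Longrightarrow> S t \<subseteq> I" "\<And>t. t \<in> T \<Longrightarrow> card (S t) = s"
    and disj: "\<And>t t'. t \<in> T \<Longrightarrow> t' \<in> T \<Longrightarrow> t \<noteq> t' \<Longrightarrow> S t \<inter> S t' = {}"
    and \<theta>: "0 \<le> \<theta>" "\<theta> \<le> 1" and a: "0 < a"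
  defines "\<mu> \<equiv> real (card T) * (1 - \<theta>) ^ s"
  shows "measure_pmf.prob (Pi_pmf I False (\<lambda>_. bernoulli_pmf \<theta>))
           {A. a \<le> \<bar>real (card {t \<in> T. \<forall>i\<in>S t. \<not> A i}) - \<mu>\<bar>} \<le> \<mu> / a\<^sup>2"
proof -
  define M where "M = Pi_pmf I False (\<lambda>_. bernoulli_pmf \<theta>)"
  define Y where "Y = (\<lambda>A. real (card {t \<in> T. \<forall>i\<in>S t. \<not> A i}))"
  define E where "E = (\<lambda>t. {A. \<forall>i\<in>S t. \<not> A i})"
  define q where "q = 1 - \<theta>"
  have prob1: "measure_pmf.prob M (E t) = q ^ s" if "t \<in> T" for t
    unfolding M_def E_def q_def using that S I \<theta> by (simp add: prob_Pi_bernoulli_all_False)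
  have prob2: "measure_pmf.prob M (E t \<inter> E t') = q ^ (2 * s)" if t: "t \<in> T" "t' \<in> T" "t \<noteq> t'" for t t'
  proof -
    have "E t \<inter> E t' = {A. \<forall>i\<in>S t \<union> S t'. \<not> A i}" by (auto simp: E_def)
    moreover have "card (S t \<union> S t') = 2 * s"
      using S[of t] S[of t'] disj[of t t'] t I by (subst card_Un_disjoint) (auto intro: finite_subset)
    ultimately show ?thesis
      unfolding M_def q_def using S I t \<theta>
      by (simp only:) (subst prob_Pi_bernoulli_all_False, auto)
  qed
  have Y: "Y A = (\<Sum>t\<in>T. indicator (E t) A)" for A
    using I by (simp add: Y_def E_def indicator_def sum.If_cases Int_def)
  have intE: "integrable M (indicator X :: _ \<Rightarrow> real)" for X
    by (rule measure_pmf.integrable_const_bound[where B = 1]) (auto simp: indicator_def)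
  have EY: "measure_pmf.expectation M Y = \<mu>"
  proof -
    have "measure_pmf.expectation M Y = (\<Sum>t\<in>T. measure_pmf.prob M (E t))"
      unfolding Y by (subst Bochner_Integration.integral_sum) (auto intro: intE)
    also have "\<dots> = \<mu>" by (simp add: prob1 \<mu>_def q_def)
    finally show ?thesis .
  qed
  have Y2: "(Y A)\<^sup>2 = (\<Sum>t\<in>T. \<Sum>t'\<in>T. indicator (E t \<inter> E t') A)" for A
    by (simp add: Y power2_eq_square sum_product indicator_inter_arith)
  have intY2: "integrable M (\<lambda>A. (Y A)\<^sup>2)"
    unfolding Y2 by (intro Bochner_Integration.integrable_sum intE)
  have intY: "integrable M Y"
    unfolding Y by (intro Bochner_Integration.integrable_sum intE)
  have "measure_pmf.expectation M (\<lambda>A. (Y A)\<^sup>2) = (\<Sum>t\<in>T. \<Sum>t'\<in>T. measure_pmf.prob M (E t \<inter> E t'))"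
    unfolding Y2 by (subst Bochner_Integration.integral_sum, auto intro!: intE Bochner_Integration.integrable_sum)+
  \<comment> \<open>The diagonal receives \<open>q ^ (2 * s)\<close> on top of its value
    \<open>q ^ s\<close>, which completes the double sum to the square of
    \<open>\<mu>\<close>.\<close>
  also have "\<dots> \<le> (\<Sum>t\<in>T. \<Sum>t'\<in>T. q ^ (2 * s) + (if t = t' then q ^ s else 0))"
    by (intro sum_mono) (use \<theta> in \<open>auto simp: prob1 prob2 q_def\<close>)
  also have "\<dots> = \<mu>\<^sup>2 + \<mu>"
    using I by (simp add: sum.distrib \<mu>_def q_def power2_eq_square power_add mult_2 distrib_left)
  finally have "measure_pmf.expectation M (\<lambda>A. (Y A)\<^sup>2) \<le> \<mu>\<^sup>2 + \<mu>" .
  then have var: "measure_pmf.variance M Y \<le> \<mu>"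
    using measure_pmf.variance_eq[OF intY intY2] by (simp add: EY)
  have "measure_pmf.prob M {A \<in> space M. a \<le> \<bar>Y A - measure_pmf.expectation M Y\<bar>} \<le> measure_pmf.variance M Y / a\<^sup>2"
    by (rule measure_pmf.Chebyshev_inequality) (use intY2 a in auto)
  also have "\<dots> \<le> \<mu> / a\<^sup>2" using var by (intro divide_right_mono) auto
  finally show ?thesis unfolding EY by (simp add: M_def Y_def)
qed

text \<open>The defining equation of \<open>nu\<close> gives
  \<open>ln (1 - nu k / k) = - ln 2 / k\<close> exactly.\<close>

lemma one_minus_nu_power:
  assumes "0 < k"
  shows "0 \<le> nu k / real k" "nu k / real k \<le> 1" "(1 - nu k / real k) ^ m = exp (- (real m * ln 2 / real k))"
proof -
  have nu: "0 < nu k \<and> nu k \<le> real k \<and> (1 - nu k / real k) ^ k = 1 / 2"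
    unfolding nu_def by (rule theI'[OF nu_ex1[OF assms]])
  then show "0 \<le> nu k / real k" "nu k / real k \<le> 1" using assms by auto
  define q where "q = 1 - nu k / real k"
  have q: "0 \<le> q" "q ^ k = 1 / 2" using nu assms by (auto simp: q_def)
  have "q \<noteq> 0" using q assms by (intro notI) (simp add: power_0_left)
  then have q0: "0 < q" using q by simp
  have "real k * ln q = ln (1 / 2)" using q q0 by (simp flip: ln_realpow)
  then have "ln q = - (ln 2 / real k)" using assms by (simp add: ln_div field_simps)
  then have "q = exp (- (ln 2 / real k))" using q0 by (metis exp_ln)
  then show "(1 - nu k / real k) ^ m = exp (- (real m * ln 2 / real k))"
    unfolding q_def[symmetric] by (simp flip: exp_of_nat_mult)
qed

text \<open>Here \<open>\<mu>\<close> is the conditional mean, given the positive tests, of the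
  number of nondefective items that avoid all negative tests. The condition
  \<open>k \<le> p_pot p n \<omega>\<close> makes the subtraction of naturals genuine.\<close>

definition typical :: "real \<Rightarrow> nat \<Rightarrow> nat \<Rightarrow> nat \<Rightarrow> outcome \<Rightarrow> bool" where
  "typical \<delta> p k n \<omega> \<longleftrightarrow>
     (let \<mu> = real (p - k) * exp (- ((real n - real (n_pos n \<omega>)) * ln 2 / real k))
      in \<bar>real (n_pos n \<omega>) - real n / 2\<bar> \<le> \<delta> * real n \<and> k \<le> p_pot p n \<omega> \<and>
         \<bar>real (p_pot p n \<omega> - k) - \<mu>\<bar> \<le> \<mu> / 2)"

text \<open>
  The columns of the defective items determine the positive tests; given these, the
  nondefective items are potentially defective independently of each other.
\<close>
lemma prob_not_typical_le:
  assumes k: "0 < k" "k < p" and n: "0 < n" and \<delta>: "0 < \<delta>"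
  defines "\<mu>0 \<equiv> real (p - k) * exp (- ((1 / 2 + \<delta>) * real n * ln 2 / real k))"
  shows "measure_pmf.prob (group_testing p k n) {\<omega>. \<not> typical \<delta> p k n \<omega>}
           \<le> 1 / (2 * \<delta>\<^sup>2 * real n) + 4 / \<mu>0"
proof -
  define \<theta> where "\<theta> = nu k / real k"
  note nu = one_minus_nu_power[OF k(1), folded \<theta>_def]
  have \<mu>0: "\<mu>0 > 0" using k by (simp add: \<mu>0_def)
  have D: "measure_pmf.prob (Pi_pmf ({1..n} \<times> {1..p}) False (\<lambda>_. bernoulli_pmf \<theta>)) {A. \<not> typical \<delta> p k n (D, A)}
     \<le> 1 / (2 * \<delta>\<^sup>2 * real n) + 4 / \<mu>0" if D: "D \<subseteq> {1..p}" "card D = k" for D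
  proof -
    define I1 where "I1 = {1..n} \<times> D"
    define I2 where "I2 = {1..n} \<times> ({1..p} - D)"
    have finD: "finite D" using D finite_subset by blast
    have fin: "finite I1" "finite I2" "I1 \<inter> I2 = {}" "{1..n} \<times> {1..p} = I1 \<union> I2"
      using D finD by (auto simp: I1_def I2_def)
    \<comment> \<open>Glue two independent parts: \<open>f\<close> holds the columns of the
      defective items and \<open>g\<close> the others, so the negative tests depend on
      \<open>f\<close> only.\<close>
    define mg where "mg = (\<lambda>(f :: nat \<times> nat \<Rightarrow> bool, g) x. if x \<in> I1 then f x else g x)"
    define Neg where "Neg = (\<lambda>f. {t \<in> {1..n}. \<forall>x\<in>{t} \<times> D. \<not> (f :: nat \<times> nat \<Rightarrow> bool) x})"
    define Pot where "Pot = (\<lambda>f g. {j \<in> {1..p} - D. \<forall>x\<in>Neg f \<times> {j}. \<not> (g :: nat \<times> nat \<Rightarrow> bool) x})"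
    have pos: "{1..n} - pos_tests n (D, mg (f, g)) = Neg f" for f g
      by (auto simp: pos_tests_def Neg_def mg_def I1_def)
    have cNeg: "card (Neg f) + n_pos n (D, mg (f, g)) = n" for f g
    proof -
      have "pos_tests n (D, mg (f, g)) \<subseteq> {1..n}" by (auto simp: pos_tests_def)
      then show ?thesis unfolding pos[of f g, symmetric] n_pos_def
        using card_mono[of "{1..n}" "pos_tests n (D, mg (f, g))"]
        by (subst card_Diff_subset) (auto intro: finite_subset)
    qed
    have pot: "pot_def p n (D, mg (f, g)) = D \<union> Pot f g" for f g
    proof -
      have "pot_def p n (D, mg (f, g)) = {j \<in> {1..p}. \<forall>i\<in>Neg f. \<not> mg (f, g) (i, j)}"
        unfolding pot_def_def pos by simp
      also have "\<dots> = D \<union> Pot f g" using D by (auto simp: Pot_def Neg_def mg_def I1_def)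
      finally show ?thesis .
    qed
    have cPot: "p_pot p n (D, mg (f, g)) = k + card (Pot f g)" for f g
      unfolding p_pot_def pot using finD D by (subst card_Un_disjoint) (auto simp: Pot_def)
    have cT: "card ({1..p} - D) = p - k" using D finD by (simp add: card_Diff_subset)
    define P where "P = (\<lambda>I :: (nat \<times> nat) set. Pi_pmf I False (\<lambda>_. bernoulli_pmf \<theta>))"
    have k2: "(1 - \<theta>) ^ k = 1 / 2" using k by (simp add: nu exp_minus)
    \<comment> \<open>The bad \<open>f\<close>: the number of negative tests is off its mean
      \<open>n / 2\<close> by at least \<open>\<delta> * n\<close>.\<close>
    define B where "B = {f. \<delta> * real n \<le> \<bar>real (card (Neg f)) - real (card {1..n}) * (1 - \<theta>) ^ k\<bar>}"
    have "measure_pmf.prob (P I1) B \<le> real (card {1..n}) * (1 - \<theta>) ^ k / (\<delta> * real n)\<^sup>2"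
      unfolding B_def Neg_def P_def
      by (rule Pi_bernoulli_all_False_deviation)
        (use fin nu(1,2) \<delta> n D in \<open>auto simp: I1_def card_cartesian_product\<close>)
    also have "\<dots> = 1 / (2 * \<delta>\<^sup>2 * real n)"
      using n \<delta> by (simp add: k2 field_simps power2_eq_square)
    finally have B: "measure_pmf.prob (P I1) B \<le> 1 / (2 * \<delta>\<^sup>2 * real n)" .
    have inner: "measure_pmf.prob (P I2) {g. \<not> typical \<delta> p k n (D, mg (f, g))} \<le> 4 / \<mu>0"
      if f: "f \<notin> B" for f
    proof -
      define \<mu> where "\<mu> = real (p - k) * (1 - \<theta>) ^ card (Neg f)"
      have fB: "\<bar>real (card (Neg f)) - real n / 2\<bar> < \<delta> * real n"
        using f by (simp add: B_def k2)
      have "real (card (Neg f)) \<le> (1 / 2 + \<delta>) * real n" using fB by (simp add: algebra_simps abs_less_iff)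
      then have "real (card (Neg f)) * ln 2 / real k \<le> (1 / 2 + \<delta>) * real n * ln 2 / real k"
        by (intro divide_right_mono mult_right_mono) auto
      \<comment> \<open>Outside \<open>B\<close> there are at most
        \<open>(1 / 2 + \<delta>) * n\<close> negative tests, so \<open>\<mu>0\<close> bounds the
        conditional mean from below uniformly in \<open>f\<close>.\<close>
      then have mu: "\<mu>0 \<le> \<mu>" unfolding \<mu>0_def \<mu>_def nu by (intro mult_left_mono) auto
      have "{g. \<not> typical \<delta> p k n (D, mg (f, g))} \<subseteq> {g. \<mu> / 2 \<le> \<bar>real (card (Pot f g)) - \<mu>\<bar>}"
      proof safe
        fix g assume nt: "\<not> typical \<delta> p k n (D, mg (f, g))"
        have c: "real n - real (n_pos n (D, mg (f, g))) = real (card (Neg f))"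
          using cNeg[of f g] by linarith
        have 1: "\<bar>real (n_pos n (D, mg (f, g))) - real n / 2\<bar> \<le> \<delta> * real n"
          using fB c by linarith
        have 2: "real (p - k) * exp (- ((real n - real (n_pos n (D, mg (f, g)))) * ln 2 / real k)) = \<mu>"
          unfolding c \<mu>_def nu ..
        from nt show "\<mu> / 2 \<le> \<bar>real (card (Pot f g)) - \<mu>\<bar>"
          unfolding typical_def Let_def 2 cPot using 1 by auto
      qed
      then have "measure_pmf.prob (P I2) {g. \<not> typical \<delta> p k n (D, mg (f, g))}
          \<le> measure_pmf.prob (P I2) {g. \<mu> / 2 \<le> \<bar>real (card (Pot f g)) - \<mu>\<bar>}"
        by (intro measure_pmf.finite_measure_mono) auto
      also have "\<dots> \<le> \<mu> / (\<mu> / 2)\<^sup>2"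
        unfolding Pot_def P_def \<mu>_def cT[symmetric]
      proof (rule Pi_bernoulli_all_False_deviation)
        show "Neg f \<times> {t} \<subseteq> I2" if "t \<in> {1..p} - D" for t using that by (auto simp: Neg_def I2_def)
        show "0 < real (card ({1..p} - D)) * (1 - \<theta>) ^ card (Neg f) / 2"
          using mu \<mu>0 unfolding cT \<mu>_def by linarith
      qed (use fin nu(1,2) in \<open>auto simp: card_cartesian_product\<close>)
      also have "\<dots> = 4 / \<mu>" using mu \<mu>0 by (simp add: power2_eq_square)
      also have "\<dots> \<le> 4 / \<mu>0" using mu \<mu>0 by (intro divide_left_mono) auto
      finally show ?thesis .
    qed
    have "measure_pmf.prob (P ({1..n} \<times> {1..p})) {A. \<not> typical \<delta> p k n (D, A)}
        = measure_pmf.prob (pair_pmf (P I1) (P I2)) {z. \<not> typical \<delta> p k n (D, mg z)}"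
      unfolding fin(4) P_def Pi_pmf_union[OF fin(1-3)] measure_map_pmf mg_def
      by (simp add: vimage_def)
    also have "\<dots> \<le> measure_pmf.prob (P I1) B + 4 / \<mu>0"
      by (rule prob_pair_pmf_le) (use inner \<mu>0 in auto)
    also have "\<dots> \<le> 1 / (2 * \<delta>\<^sup>2 * real n) + 4 / \<mu>0" using B by simp
    finally show ?thesis by (simp add: P_def)
  qed
  have ne: "{D. D \<subseteq> {1..p} \<and> card D = k} \<noteq> {}"
    using obtain_subset_with_card_n[of k "{1..p}"] k by auto
  have "finite {D. D \<subseteq> {1..p} \<and> card D = k}" by simp
  note set = set_pmf_of_set[OF ne this]
  have "measure_pmf.prob (group_testing p k n) {\<omega>. \<not> typical \<delta> p k n \<omega>}
      \<le> measure_pmf.prob (pmf_of_set {D. D \<subseteq> {1..p} \<and> card D = k}) {} + (1 / (2 * \<delta>\<^sup>2 * real n) + 4 / \<mu>0)"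
    unfolding group_testing_def
    by (rule prob_pair_pmf_le) (use D \<mu>0 in \<open>auto simp del: One_nat_def simp: set \<theta>_def\<close>)
  then show ?thesis by simp
qed

section \<open>Typical outcomes\<close>

lemma aas_mono2:
  assumes "aas M A" "aas M B" "\<forall>\<^sub>F p in sequentially. \<forall>\<omega>. A p \<omega> \<and> B p \<omega> \<longrightarrow> E p \<omega>"
  shows "aas M E"
  unfolding aas_def
proof (rule tendsto_sandwich[where h = "\<lambda>_. 1"])
  show "\<forall>\<^sub>F p in sequentially. measure_pmf.prob (M p) {\<omega>. A p \<omega>} + measure_pmf.prob (M p) {\<omega>. B p \<omega>} - 1
      \<le> measure_pmf.prob (M p) {\<omega>. E p \<omega>}"
    using assms(3)
  proof eventually_elim
    case (elim p)
    let ?P = "measure_pmf.prob (M p)"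
    have "?P (- {\<omega>. E p \<omega>}) \<le> ?P (- {\<omega>. A p \<omega>} \<union> - {\<omega>. B p \<omega>})"
      using elim by (intro measure_pmf.finite_measure_mono) auto
    also have "\<dots> \<le> ?P (- {\<omega>. A p \<omega>}) + ?P (- {\<omega>. B p \<omega>})"
      by (rule measure_Un_le) auto
    finally show ?case
      using measure_pmf.prob_compl[of "{\<omega>. A p \<omega>}" "M p"] measure_pmf.prob_compl[of "{\<omega>. B p \<omega>}" "M p"]
        measure_pmf.prob_compl[of "{\<omega>. E p \<omega>}" "M p"]
      by (simp add: Compl_eq_Diff_UNIV)
  qed
  show "(\<lambda>p. measure_pmf.prob (M p) {\<omega>. A p \<omega>} + measure_pmf.prob (M p) {\<omega>. B p \<omega>} - 1) \<longlonglongrightarrow> 1"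
    using tendsto_diff[OF tendsto_add[OF assms(1,2)[unfolded aas_def]] tendsto_const[of 1]] by simp
qed (auto intro: always_eventually)

lemma aas_of_prob_compl_le:
  assumes "\<forall>\<^sub>F p in sequentially. measure_pmf.prob (M p) {\<omega>. \<not> E p \<omega>} \<le> e p" "e \<longlonglongrightarrow> 0"
  shows "aas M E"
  unfolding aas_def
proof (rule tendsto_sandwich[where h = "\<lambda>_. 1"])
  show "\<forall>\<^sub>F p in sequentially. 1 - e p \<le> measure_pmf.prob (M p) {\<omega>. E p \<omega>}"
    using assms(1)
  proof eventually_elim
    case (elim p)
    have "{\<omega>. \<not> E p \<omega>} = UNIV - {\<omega>. E p \<omega>}" by auto
    then show ?case using elim measure_pmf.prob_compl[of "{\<omega>. E p \<omega>}" "M p"] by simp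
  qed
  show "(\<lambda>p. 1 - e p) \<longlonglongrightarrow> 1" using tendsto_diff[OF tendsto_const assms(2), of 1] by simp
qed (auto intro: always_eventually)

section \<open>From values of \<open>phi\<close> to the absence of an overlap gap\<close>

lemma first_moment_closeE:
  assumes "first_moment_close p k n \<omega> l B"
  obtains x y where "is_first_moment (p_pot p n \<omega>) k (n_pos n \<omega>) (real l / real k) x"
    "phi p k n \<omega> l = ereal y" "\<bar>y - real (n_pos n \<omega>) * x\<bar> \<le> B"
proof -
  let ?x = "first_moment (p_pot p n \<omega>) k (n_pos n \<omega>) (real l / real k)"
  have 1: "is_first_moment (p_pot p n \<omega>) k (n_pos n \<omega>) (real l / real k) ?x"
    unfolding first_moment_def by (rule theI') (use assms in \<open>unfold first_moment_close_def, elim conjE\<close>)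
  have 2: "\<bar>phi p k n \<omega> l - ereal (real (n_pos n \<omega>) * ?x)\<bar> \<le> ereal B"
    using assms unfolding first_moment_close_def by (rule conjunct2)
  \<comment> \<open>A real bound on the distance rules out both infinite values.\<close>
  then obtain y where y: "phi p k n \<omega> l = ereal y" by (cases "phi p k n \<omega> l") auto
  have "\<bar>y - real (n_pos n \<omega>) * ?x\<bar> \<le> B" using 2 unfolding y by simp
  then show thesis using that 1 y by blast
qed

text \<open>Condition (2) gives \<open>phi p k n \<omega> l \<le> r\<close> for some
  \<open>l \<le> \<zeta>\<close>. A smaller value at an overlap from \<open>\<zeta> + 1\<close> to
  \<open>\<zeta> + W\<close> then comes from a vector that (1) forbids.\<close>

lemma not_OGP_if_phi_less:
  assumes "\<And>l. l \<le> \<zeta> \<Longrightarrow> \<exists>l'. \<zeta> < l' \<and> l' \<le> \<zeta> + W \<and> phi p k n \<omega> l' < phi p k n \<omega> l"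
  shows "\<not> OGP p k n \<omega> \<zeta> W H\<^sub>0"
proof
  assume "OGP p k n \<omega> \<zeta> W H\<^sub>0"
  then obtain r \<theta>\<^sub>1 \<theta>\<^sub>2 where
    r: "\<forall>\<theta>\<in>sparse_vecs p k n \<omega>. real (H p n \<omega> \<theta>) \<le> r \<longrightarrow>
          overlap p n \<omega> \<theta> \<le> \<zeta> \<or> overlap p n \<omega> \<theta> \<ge> \<zeta> + W + 1"
    and th: "\<theta>\<^sub>1 \<in> sparse_vecs p k n \<omega>" "overlap p n \<omega> \<theta>\<^sub>1 \<le> \<zeta>"
      "real (max (H p n \<omega> \<theta>\<^sub>1) (H p n \<omega> \<theta>\<^sub>2)) \<le> r"
    unfolding OGP_def by blast
  from assms[OF th(2)] obtain l' where
    l': "\<zeta> < l'" "l' \<le> \<zeta> + W" "phi p k n \<omega> l' < phi p k n \<omega> (overlap p n \<omega> \<theta>\<^sub>1)" by blast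
  have "phi p k n \<omega> (overlap p n \<omega> \<theta>\<^sub>1) \<le> ereal (real (H p n \<omega> \<theta>\<^sub>1))"
    unfolding phi_def using th by (intro INF_lower) auto
  also have "\<dots> \<le> ereal r" using th(3) by (simp add: of_nat_max)
  finally have "phi p k n \<omega> l' < ereal r" using l' by (meson less_le_trans)
  then obtain \<theta> where "\<theta> \<in> sparse_vecs p k n \<omega>" "overlap p n \<omega> \<theta> = l'" "real (H p n \<omega> \<theta>) < r"
    unfolding phi_def INF_less_iff by auto
  then show False using r l' by fastforce
qed

text \<open>With about \<open>n / 2\<close> positive tests, \<open>ln ((p' - k) / k)\<close> is near
  \<open>L - v / 2\<close> and \<open>M / k\<close> is near \<open>v / 2\<close>. If
  \<open>L\<close> is near \<open>R * v\<close>, their ratio is near \<open>2 * R - 1\<close>, which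
  for \<open>1 / 2 < R < 1\<close> lies strictly between \<open>R - 1 / 2\<close> and
  \<open>R\<close>. The hypotheses \<open>up\<close> and \<open>lo\<close> express this
  slack.\<close>

lemma typical_bounds:
  fixes p k n :: nat and R \<delta> :: real
  defines "v \<equiv> real n * ln 2 / real k" and "L \<equiv> ln (real p / real k)"
  assumes tp: "typical \<delta> p k n \<omega>" and k: "0 < k" "2 * k \<le> p"
    and R: "1 / 2 < R" "0 < \<delta>" "\<delta> < 1 / 2"
    and up: "L + ln 2 \<le> (1 + R) * ((1 / 2 - \<delta>) * v)"
    and lo: "(1 / 2 + R) * ((1 / 2 + \<delta>) * v) \<le> L - 2 * ln 2"
  defines "M \<equiv> real (n_pos n \<omega>) * ln 2"
  shows "k \<le> p_pot p n \<omega> - k"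
    "(R - 1 / 2) * M \<le> real k * ln (real (p_pot p n \<omega> - k) / real k)"
    "real k * ln (real (p_pot p n \<omega> - k) / real k) \<le> R * M"
    "real k * ((1 / 2 - \<delta>) * v) \<le> M"
proof -
  define \<mu> where "\<mu> = real (p - k) * exp (- ((real n - real (n_pos n \<omega>)) * ln 2 / real k))"
  define X where "X = real (p_pot p n \<omega> - k)"
  have m: "\<bar>real (n_pos n \<omega>) - real n / 2\<bar> \<le> \<delta> * real n" and X: "\<bar>X - \<mu>\<bar> \<le> \<mu> / 2"
    using tp unfolding typical_def Let_def \<mu>_def X_def by blast+
  have pk: "real (p - k) = real p - real k" "real p - real k > 0" using k by auto
  have mu: "\<mu> > 0" unfolding \<mu>_def pk using pk by (intro mult_pos_pos) auto
  have X': "\<mu> / 2 \<le> X" "X \<le> 2 * \<mu>" using X mu by linarith+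
  then have X0: "X > 0" using mu by linarith
  define v1 where "v1 = M / real k"
  have nv: "real n * ln 2 / real k = v" by (simp add: v_def)
  have "real n * (1 / 2 - \<delta>) \<le> real (n_pos n \<omega>)" "real (n_pos n \<omega>) \<le> real n * (1 / 2 + \<delta>)"
    using m by (auto simp: abs_le_iff algebra_simps)
  then have "real n * (1 / 2 - \<delta>) * (ln 2 / real k) \<le> real (n_pos n \<omega>) * (ln 2 / real k)"
    "real (n_pos n \<omega>) * (ln 2 / real k) \<le> real n * (1 / 2 + \<delta>) * (ln 2 / real k)"
    by (intro mult_right_mono; simp)+
  then have v1: "(1 / 2 - \<delta>) * v \<le> v1" "v1 \<le> (1 / 2 + \<delta>) * v"
    by (simp_all add: v_def v1_def M_def mult_ac)
  \<comment> \<open>Thus \<open>v - v1\<close>, the share of the negative tests, obeys the same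
    bounds as \<open>v1\<close>.\<close>
  have sum: "(1 / 2 - \<delta>) * v + (1 / 2 + \<delta>) * v = v" by (simp add: algebra_simps)
  have v0: "0 \<le> v" by (simp add: v_def)
  have ln\<mu>: "ln (\<mu> / real k) = ln (real (p - k) / real k) - (v - v1)"
  proof -
    have "(real n - real (n_pos n \<omega>)) * ln 2 / real k = v - v1"
      by (simp add: v_def v1_def M_def left_diff_distrib diff_divide_distrib)
    then show ?thesis unfolding \<mu>_def using k pk by (simp add: ln_mult ln_div)
  qed
  have "ln (real (p - k) / real k) \<le> L"
    unfolding L_def using k by (subst ln_le_cancel_iff) (auto simp: divide_right_mono)
  moreover have "ln (real p / real k / 2) \<le> ln (real (p - k) / real k)"
    using k by (subst ln_le_cancel_iff) (auto simp: field_simps)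
  then have "L - ln 2 \<le> ln (real (p - k) / real k)"
    unfolding L_def using k by (subst (asm) ln_div) auto
  moreover have "ln (X / real k) \<le> ln (2 * \<mu> / real k)"
    using X' X0 k by (subst ln_le_cancel_iff) (auto simp: divide_right_mono)
  then have "ln (X / real k) \<le> ln 2 + ln (\<mu> / real k)" using mu k by (simp add: ln_div ln_mult)
  moreover have "ln (\<mu> / 2 / real k) \<le> ln (X / real k)"
    using X' X0 mu k by (subst ln_le_cancel_iff) (auto simp: field_simps)
  then have "ln (\<mu> / real k) - ln 2 \<le> ln (X / real k)" using mu k by (simp add: ln_div ln_mult)
  \<comment> \<open>Each \<open>ln 2\<close> stands for a factor \<open>2\<close>: between
    \<open>p\<close> and \<open>p - k\<close>, because \<open>2 * k \<le> p\<close>, and between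
    \<open>X\<close> and \<open>\<mu>\<close>.\<close>
  ultimately have g: "ln (X / real k) \<le> L + ln 2 - (v - v1)" "L - 2 * ln 2 - (v - v1) \<le> ln (X / real k)"
    unfolding ln\<mu> by linarith+
  have A: "(1 + R) * ((1 / 2 - \<delta>) * v) = (1 / 2 - \<delta>) * v + R * ((1 / 2 - \<delta>) * v)"
    "(1 / 2 + R) * ((1 / 2 + \<delta>) * v) = (1 / 2 + \<delta>) * v + (R - 1 / 2) * ((1 / 2 + \<delta>) * v)"
    by (simp_all add: algebra_simps)
  have B: "R * ((1 / 2 - \<delta>) * v) \<le> R * v1" "(R - 1 / 2) * v1 \<le> (R - 1 / 2) * ((1 / 2 + \<delta>) * v)"
    using v1 R by (auto intro!: mult_left_mono)
  have up': "ln (X / real k) \<le> R * v1"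
  proof -
    have "v - v1 \<ge> (1 / 2 - \<delta>) * v" using v1 sum by linarith
    then show ?thesis using g(1) up A(1) B(1) by linarith
  qed
  have lo': "(R - 1 / 2) * v1 \<le> ln (X / real k)"
  proof -
    have "v - v1 \<le> (1 / 2 + \<delta>) * v" using v1 sum by linarith
    then show ?thesis using g(2) lo A(2) B(2) by linarith
  qed
  have kv1: "real k * v1 = M" using k by (simp add: v1_def)
  have "0 \<le> (1 / 2 - \<delta>) * v" using R v0 by simp
  then have "0 \<le> v1" using v1 by linarith
  then have "0 \<le> ln (X / real k)" using lo' R mult_nonneg_nonneg[of "R - 1/2" v1] by linarith
  then have "1 \<le> X / real k" using X0 k by (subst (asm) ln_ge_zero_iff) auto
  then show "k \<le> p_pot p n \<omega> - k" using k by (simp add: X_def)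
  show "(R - 1 / 2) * M \<le> real k * ln (real (p_pot p n \<omega> - k) / real k)"
    using mult_left_mono[OF lo', of "real k"] by (simp add: X_def mult_ac flip: kv1)
  show "real k * ln (real (p_pot p n \<omega> - k) / real k) \<le> R * M"
    using mult_left_mono[OF up', of "real k"] by (simp add: X_def mult_ac flip: kv1)
  show "real k * ((1 / 2 - \<delta>) * v) \<le> M"
    using mult_left_mono[OF v1(1), of "real k"] by (simp flip: kv1)
qed

section \<open>Growth of the number of tests at a fixed rate\<close>

lemma items_per_defective_at_top:
  fixes k :: "nat \<Rightarrow> nat"
  assumes "filterlim k at_top sequentially" "(\<lambda>p. real (k p)) \<in> o(\<lambda>p. real p)"
  shows "filterlim (\<lambda>p. real p / real (k p)) at_top sequentially"
proof -
  have "((\<lambda>p. real (k p) / real p) \<longlongrightarrow> 0) sequentially"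
    using smalloD_tendsto[OF assms(2)] by simp
  moreover have "\<forall>\<^sub>F p in sequentially. real (k p) / real p > 0"
    using eventually_gt_at_top[of 0] eventually_compose_filterlim[OF eventually_gt_at_top[of 0] assms(1)]
    by eventually_elim simp
  ultimately have "filterlim (\<lambda>p. inverse (real (k p) / real p)) at_top sequentially"
    by (intro filterlim_inverse_at_top)
  then show ?thesis by simp
qed

text \<open>With \<open>L = ln (p / k)\<close>, the logarithm of \<open>p choose k\<close> is
  \<open>k * L\<close> up to an error of at most \<open>k\<close>, and rounding \<open>n\<close>
  changes \<open>n * ln 2 / k\<close> by at most \<open>1\<close>. Both errors vanish against
  \<open>L\<close> after division by \<open>k\<close>, respectively directly.\<close>

lemma rate_asymptotics:
  fixes k n :: "nat \<Rightarrow> nat" and R :: real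
  assumes R: "0 < R"
    and k_at_top: "filterlim k at_top sequentially"
    and k_small: "(\<lambda>p. real (k p)) \<in> o(\<lambda>p. real p)"
    and rate: "\<forall>\<^sub>F p in sequentially. \<bar>real (n p) - log 2 (real (p choose k p)) / R\<bar> < 1"
  shows "filterlim (\<lambda>p. ln (real p / real (k p))) at_top sequentially" (is "filterlim ?L _ _")
    "(\<lambda>p. (real (n p) * ln 2 / real (k p)) / ln (real p / real (k p))) \<longlonglongrightarrow> 1 / R"
      (is "(\<lambda>p. ?v p / _) \<longlonglongrightarrow> _")
proof -
  note pk = items_per_defective_at_top[OF k_at_top k_small]
  show L: "filterlim ?L at_top sequentially"
    using filterlim_compose[OF ln_at_top pk] .
  have inv: "(\<lambda>p. 1 / ?L p) \<longlonglongrightarrow> 0"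
    using tendsto_inverse_0_at_top[OF L] by (simp add: divide_inverse)
  have ev: "\<forall>\<^sub>F p in sequentially. 1 / R - 1 / ?L p \<le> ?v p / ?L p \<and> ?v p / ?L p \<le> 1 / R + (1 / R + 1) * (1 / ?L p)"
    using rate eventually_compose_filterlim[OF eventually_gt_at_top[of 0] k_at_top]
      filterlim_at_top_dense[THEN iffD1, OF L, rule_format, of 0]
      filterlim_at_top_dense[THEN iffD1, OF pk, rule_format, of 1]
  proof eventually_elim
    case (elim p)
    define L where "L = ?L p"
    define v where "v = ?v p"
    have k: "0 < k p" and Lp: "0 < L" using elim by (auto simp: L_def)
    have kp: "k p \<le> p" using elim by (simp add: field_simps)
    have c: "real (k p) * L \<le> ln (real (p choose k p))" "ln (real (p choose k p)) \<le> real (k p) * (L + 1)"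
      unfolding L_def using ln_binomial_ge[OF k kp] ln_binomial_le[OF k kp] by auto
    define c where "c = ln (real (p choose k p)) / real (k p)"
    have c': "L \<le> c" "c \<le> L + 1" using c k by (auto simp: c_def field_simps)
    have "\<bar>real (n p) - log 2 (real (p choose k p)) / R\<bar> * (ln 2 / real (k p)) \<le> 1 * (ln 2 / real (k p))"
      using elim by (intro mult_right_mono) auto
    moreover have "\<bar>real (n p) - log 2 (real (p choose k p)) / R\<bar> * (ln 2 / real (k p))
        = \<bar>(real (n p) - log 2 (real (p choose k p)) / R) * (ln 2 / real (k p))\<bar>"
      by (simp add: abs_mult)
    moreover have "(real (n p) - log 2 (real (p choose k p)) / R) * (ln 2 / real (k p)) = v - c / R"
      using k R by (simp add: v_def c_def log_def field_simps)
    moreover have "ln 2 / real (k p) \<le> 1"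
      using ln_2_less_1 k by (simp add: field_simps)
    ultimately have "\<bar>v - c / R\<bar> \<le> 1" by (metis mult_1 order_trans)
    moreover have "L / R \<le> c / R" "c / R \<le> (L + 1) / R"
      using c' R by (auto intro: divide_right_mono)
    ultimately have "L / R - 1 \<le> v" "v \<le> (L + 1) / R + 1" by linarith+
    then have "(L / R - 1) / L \<le> v / L" "v / L \<le> ((L + 1) / R + 1) / L"
      using Lp by (intro divide_right_mono; simp)+
    moreover have "(L / R - 1) / L = 1 / R - 1 / L" "((L + 1) / R + 1) / L = 1 / R + (1 / R + 1) * (1 / L)"
      using Lp R by (simp_all add: field_simps)
    ultimately show ?case by (simp add: L_def v_def)
  qed
  show "(\<lambda>p. ?v p / ?L p) \<longlonglongrightarrow> 1 / R"
  proof (rule tendsto_sandwich)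
    show "(\<lambda>p. 1 / R - 1 / ?L p) \<longlonglongrightarrow> 1 / R"
      using tendsto_diff[OF tendsto_const inv, of "1 / R"] by simp
    show "(\<lambda>p. 1 / R + (1 / R + 1) * (1 / ?L p)) \<longlonglongrightarrow> 1 / R"
      using tendsto_add[OF tendsto_const tendsto_mult_left[OF inv], of "1 / R" "1 / R + 1"] by simp
    show "\<forall>\<^sub>F p in sequentially. 1 / R - 1 / ?L p \<le> ?v p / ?L p"
      using ev by (rule eventually_mono) (rule conjunct1)
    show "\<forall>\<^sub>F p in sequentially. ?v p / ?L p \<le> 1 / R + (1 / R + 1) * (1 / ?L p)"
      using ev by (rule eventually_mono) (rule conjunct2)
  qed
qed

section \<open>No overlap gap\<close>

text \<open>Since \<open>v / L\<close> tends to \<open>1 / R\<close>, strict inequalities between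
  the limits suffice; the additive constants vanish against \<open>L\<close>.\<close>

lemma rate_eventually_bounds:
  fixes L v :: "nat \<Rightarrow> real" and R :: real
  assumes R: "1 / 2 < R" "R < 1"
    and L: "filterlim L at_top sequentially" and vL: "(\<lambda>p. v p / L p) \<longlonglongrightarrow> 1 / R"
  obtains \<delta> where "0 < \<delta>" "\<delta> < 1 / 2"
    "\<forall>\<^sub>F p in sequentially. L p + ln 2 \<le> (1 + R) * ((1 / 2 - \<delta>) * v p)"
    "\<forall>\<^sub>F p in sequentially. (1 / 2 + R) * ((1 / 2 + \<delta>) * v p) \<le> L p - 2 * ln 2"
    "\<forall>\<^sub>F p in sequentially. L p \<le> v p"
proof -
  \<comment> \<open>The two bounds on \<open>\<delta>\<close> are equivalent to
    \<open>(1 + R) * (1 / 2 - \<delta>) > R\<close> and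
    \<open>(1 / 2 + R) * (1 / 2 + \<delta>) < R\<close>.\<close>
  define \<delta> where "\<delta> = min ((1 - R) / (2 * (1 + R))) ((2 * R - 1) / (2 * (2 * R + 1))) / 2"
  have m: "0 < (1 - R) / (2 * (1 + R))" "0 < (2 * R - 1) / (2 * (2 * R + 1))" using R by auto
  have "0 < min A B / 2" "min A B / 2 < A" "min A B / 2 < B" if "0 < A" "0 < B" for A B :: real
    using that by (auto simp: min_def)
  from this[OF m] have d: "0 < \<delta>" "\<delta> < (1 - R) / (2 * (1 + R))" "\<delta> < (2 * R - 1) / (2 * (2 * R + 1))"
    unfolding \<delta>_def .
  have "(1 - R) / (2 * (1 + R)) < 1 / 2" using R by (simp add: field_simps)
  then have d2: "\<delta> < 1 / 2" using d by linarith
  have c1: "(1 + R) * (1 / 2 - \<delta>) * (1 / R) > 1" using d R by (simp add: field_simps)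
  have c2: "(1 / 2 + R) * (1 / 2 + \<delta>) * (1 / R) < 1" using d R by (simp add: field_simps)
  have inv: "(\<lambda>p. 1 / L p) \<longlonglongrightarrow> 0"
    using tendsto_inverse_0_at_top[OF L] by (simp add: divide_inverse)
  have L0: "\<forall>\<^sub>F p in sequentially. L p > 0"
    using filterlim_at_top_dense[THEN iffD1, OF L, rule_format, of 0] .
  have "(\<lambda>p. (1 + R) * (1 / 2 - \<delta>) * (v p / L p) - ln 2 * (1 / L p)) \<longlonglongrightarrow> (1 + R) * (1 / 2 - \<delta>) * (1 / R) - ln 2 * 0"
    by (intro tendsto_intros vL inv)
  then have "\<forall>\<^sub>F p in sequentially. (1 + R) * (1 / 2 - \<delta>) * (v p / L p) - ln 2 * (1 / L p) > 1"
    by (rule order_tendstoD(1)) (use c1 in simp)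
  with L0 have 1: "\<forall>\<^sub>F p in sequentially. L p + ln 2 \<le> (1 + R) * ((1 / 2 - \<delta>) * v p)"
  proof eventually_elim
    case (elim p)
    have "L p * 1 < L p * ((1 + R) * (1 / 2 - \<delta>) * (v p / L p) - ln 2 * (1 / L p))"
      using elim by (intro mult_strict_left_mono)
    also have "\<dots> = (1 + R) * ((1 / 2 - \<delta>) * v p) - ln 2" using elim by (simp add: right_diff_distrib)
    finally show ?case by simp
  qed
  have "(\<lambda>p. (1 / 2 + R) * (1 / 2 + \<delta>) * (v p / L p) + 2 * ln 2 * (1 / L p)) \<longlonglongrightarrow> (1 / 2 + R) * (1 / 2 + \<delta>) * (1 / R) + 2 * ln 2 * 0"
    by (intro tendsto_intros vL inv)
  then have "\<forall>\<^sub>F p in sequentially. (1 / 2 + R) * (1 / 2 + \<delta>) * (v p / L p) + 2 * ln 2 * (1 / L p) < 1"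
    by (rule order_tendstoD(2)) (use c2 in simp)
  with L0 have 2: "\<forall>\<^sub>F p in sequentially. (1 / 2 + R) * ((1 / 2 + \<delta>) * v p) \<le> L p - 2 * ln 2"
  proof eventually_elim
    case (elim p)
    have "L p * ((1 / 2 + R) * (1 / 2 + \<delta>) * (v p / L p) + 2 * ln 2 * (1 / L p)) < L p * 1"
      using elim by (intro mult_strict_left_mono)
    moreover have "L p * ((1 / 2 + R) * (1 / 2 + \<delta>) * (v p / L p) + 2 * ln 2 * (1 / L p))
        = (1 / 2 + R) * ((1 / 2 + \<delta>) * v p) + 2 * ln 2" using elim by (simp add: distrib_left)
    ultimately show ?case by simp
  qed
  have "1 < 1 / R" using R by simp
  then have "\<forall>\<^sub>F p in sequentially. v p / L p > 1" by (rule order_tendstoD(1)[OF vL])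
  with L0 have "\<forall>\<^sub>F p in sequentially. L p \<le> v p"
    by eventually_elim (simp add: field_simps)
  with d d2 1 2 show thesis by (intro that)
qed

text \<open>Both Chebyshev errors vanish: \<open>n\<close> is at least \<open>L\<close>, and the
  lower bound \<open>\<mu>0\<close> on the conditional mean is at least half of a positive power of
  \<open>p / k\<close>.\<close>

lemma aas_typical:
  fixes k n :: "nat \<Rightarrow> nat" and R \<delta> :: real
  defines "L \<equiv> \<lambda>p. ln (real p / real (k p))" and "v \<equiv> \<lambda>p. real (n p) * ln 2 / real (k p)"
  assumes R: "1 / 2 < R" and \<delta>: "0 < \<delta>"
    and k0: "\<forall>\<^sub>F p in sequentially. 0 < k p \<and> 2 * k p \<le> p"
    and L: "filterlim L at_top sequentially"
    and lo: "\<forall>\<^sub>F p in sequentially. (1 / 2 + R) * ((1 / 2 + \<delta>) * v p) \<le> L p - 2 * ln 2"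
    and Lv: "\<forall>\<^sub>F p in sequentially. L p \<le> v p"
  shows "aas (\<lambda>p. group_testing p (k p) (n p)) (\<lambda>p. typical \<delta> p (k p) (n p))"
proof (rule aas_of_prob_compl_le)
  \<comment> \<open>By \<open>lo\<close>, \<open>(1 / 2 + \<delta>) * v\<close> is at most
    \<open>L / (1 / 2 + R)\<close>, which leaves at least \<open>r * L\<close> of \<open>L\<close>;
    \<open>r\<close> is positive as \<open>R > 1 / 2\<close>.\<close>
  define r where "r = 1 - 1 / (1 / 2 + R)"
  have r: "0 < r" using R by (simp add: r_def)
  define e where "e = (\<lambda>p. 1 / (2 * \<delta>\<^sup>2) * inverse (L p) + 8 * exp (- (r * L p)))"
  show "\<forall>\<^sub>F p in sequentially. measure_pmf.prob (group_testing p (k p) (n p)) {\<omega>. \<not> typical \<delta> p (k p) (n p) \<omega>} \<le> e p"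
    using k0 lo Lv filterlim_at_top_dense[THEN iffD1, OF L, rule_format, of 0]
  proof eventually_elim
    case (elim p)
    have k: "0 < k p" "k p < p" using elim by auto
    have kr: "1 \<le> real (k p)" "2 * real (k p) \<le> real p" using elim by auto
    have "v p \<le> real (n p)"
    proof -
      have "ln 2 / real (k p) \<le> 1" using ln_2_less_1 kr by (simp add: field_simps)
      then have "real (n p) * (ln 2 / real (k p)) \<le> real (n p) * 1" by (intro mult_left_mono) auto
      then show ?thesis by (simp add: v_def)
    qed
    then have n: "L p \<le> real (n p)" "0 < real (n p)" using elim by linarith+
    define \<mu>0 where "\<mu>0 = real (p - k p) * exp (- ((1 / 2 + \<delta>) * real (n p) * ln 2 / real (k p)))"
    have "exp (r * L p) / 2 \<le> \<mu>0"
    proof -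
      have "(1 / 2 + \<delta>) * v p \<le> (L p - 2 * ln 2) / (1 / 2 + R)"
        using elim R by (simp add: pos_le_divide_eq mult.commute)
      also have "\<dots> \<le> L p / (1 / 2 + R)" using R by (intro divide_right_mono) auto
      finally have "r * L p \<le> L p - (1 / 2 + \<delta>) * v p" by (simp add: r_def left_diff_distrib)
      then have "exp (r * L p) \<le> exp (L p) * exp (- ((1 / 2 + \<delta>) * v p))" by (simp flip: exp_add)
      also have "exp (L p) = real p / real (k p)" unfolding L_def using kr by simp
      finally have "exp (r * L p) / 2 \<le> real p / real (k p) / 2 * exp (- ((1 / 2 + \<delta>) * v p))" by simp
      also have "\<dots> \<le> real (p - k p) * exp (- ((1 / 2 + \<delta>) * v p))"
      proof (rule mult_right_mono)
        have "real p / real (k p) / 2 \<le> real p / 2" using kr by (simp add: field_simps mult_left_le)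
        also have "\<dots> \<le> real (p - k p)" using kr k by (simp add: of_nat_diff)
        finally show "real p / real (k p) / 2 \<le> real (p - k p)" .
      qed simp
      also have "\<dots> = \<mu>0" by (simp add: \<mu>0_def v_def mult_ac)
      finally show ?thesis .
    qed
    moreover have "0 < \<mu>0" unfolding \<mu>0_def using k by simp
    ultimately have "4 / \<mu>0 \<le> 4 / (exp (r * L p) / 2)"
      by (intro divide_left_mono mult_pos_pos) auto
    also have "\<dots> = 8 * exp (- (r * L p))" by (simp add: exp_minus field_simps)
    finally have 1: "4 / \<mu>0 \<le> 8 * exp (- (r * L p))" .
    have "1 / (2 * \<delta>\<^sup>2 * real (n p)) = 1 / (2 * \<delta>\<^sup>2) * inverse (real (n p))" by (simp add: field_simps)
    also have "\<dots> \<le> 1 / (2 * \<delta>\<^sup>2) * inverse (L p)"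
      using n elim by (intro mult_left_mono le_imp_inverse_le) auto
    finally have 2: "1 / (2 * \<delta>\<^sup>2 * real (n p)) \<le> 1 / (2 * \<delta>\<^sup>2) * inverse (L p)" .
    have "measure_pmf.prob (group_testing p (k p) (n p)) {\<omega>. \<not> typical \<delta> p (k p) (n p) \<omega>}
        \<le> 1 / (2 * \<delta>\<^sup>2 * real (n p)) + 4 / \<mu>0"
      unfolding \<mu>0_def using prob_not_typical_le[OF k _ \<delta>] n by auto
    then show ?case using 1 2 by (simp add: e_def)
  qed
  have "((\<lambda>p. exp (- (r * L p))) \<longlongrightarrow> 0) sequentially"
    by (intro filterlim_compose[OF exp_at_bot] filterlim_compose[OF filterlim_uminus_at_bot_at_top]
        filterlim_tendsto_pos_mult_at_top[OF tendsto_const r L])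
  then have "e \<longlonglongrightarrow> 1 / (2 * \<delta>\<^sup>2) * 0 + 8 * 0"
    unfolding e_def by (intro tendsto_add tendsto_mult tendsto_const tendsto_inverse_0_at_top[OF L])
  then show "e \<longlonglongrightarrow> 0" by simp
qed

text \<open>The deterministic core: every \<open>l \<le> \<zeta>\<close> is followed, more than
  \<open>Z\<close> steps later, by a point \<open>l'\<close> inside the gap. Over these steps
  \<open>m * F\<close> falls by more than \<open>2 * C * ln k\<close>, which exceeds the errors of
  \<open>phi\<close> at both ends.\<close>

lemma no_OGP_of_typical:
  fixes p k n W \<zeta> :: nat and R \<delta> h C Z :: real
  defines "v \<equiv> real n * ln 2 / real k" and "L \<equiv> ln (real p / real k)"
    and "a \<equiv> ((1 - R) / 2 * (h * ln 2) / 4)\<^sup>2"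
  assumes tp: "typical \<delta> p k n \<omega>"
    and close: "\<And>l. real l \<le> (1 - h) * real k \<Longrightarrow> first_moment_close p k n \<omega> l (C * ln (real k))"
    and k: "1 < k" "2 * k \<le> p" and R: "1 / 2 < R" "R < 1" and \<delta>: "0 < \<delta>" "\<delta> < 1 / 2"
    and h: "0 < h" "h \<le> 1"
    and up: "L + ln 2 \<le> (1 + R) * ((1 / 2 - \<delta>) * v)"
    and lo: "(1 / 2 + R) * ((1 / 2 + \<delta>) * v) \<le> L - 2 * ln 2"
    and v1: "ln 2 / h + ln (1 / h) + 1 \<le> (1 - R) / 2 * ((1 / 2 - \<delta>) * v)"
    and v2: "2 * ln (1 / h) \<le> (R - 1 / 2) * a / 2 * ((1 / 2 - \<delta>) * v)"
    and c: "0 < c" "c * ln (real k) \<le> v"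
    and Z: "2 * C < (R - 1 / 2) * a\<^sup>2 / 2 * ((1 / 2 - \<delta>) * c) * Z"
    and \<zeta>: "real \<zeta> \<le> (1 - 2 * h) * real k"
    and W: "0 \<le> Z" "Z < real W" "Z + 1 < h * real k"
  shows "\<not> OGP p k n \<omega> \<zeta> W H\<^sub>0"
proof (rule not_OGP_if_phi_less)
  fix l assume l: "l \<le> \<zeta>"
  define m where "m = n_pos n \<omega>"
  define M where "M = real m * ln 2"
  define q where "q = p_pot p n \<omega>"
  have k0: "0 < k" using k by simp
  note B = typical_bounds[OF tp k0 k(2) R(1) \<delta> up[unfolded L_def v_def] lo[unfolded L_def v_def],
      folded v_def q_def m_def, folded M_def]
  \<comment> \<open>At most \<open>W\<close> steps beyond \<open>\<zeta>\<close> keep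
    \<open>l'\<close> inside the gap; at most \<open>h * k\<close> steps keep it below
    \<open>(1 - h) * k\<close>, where \<open>phi\<close> is controlled.\<close>
  define l' where "l' = \<zeta> + min W (nat \<lfloor>h * real k\<rfloor>)"
  have hk: "0 \<le> h * real k" using h by simp
  have f: "real (nat \<lfloor>h * real k\<rfloor>) \<le> h * real k" "h * real k - 1 < real (nat \<lfloor>h * real k\<rfloor>)"
    using hk by (simp_all add: of_nat_nat)
  have Zl: "Z < real (min W (nat \<lfloor>h * real k\<rfloor>))" using W f(2) unfolding of_nat_min by linarith
  then have "\<zeta> < l'" "l' \<le> \<zeta> + W" using W by (auto simp: l'_def)
  have "real (min W (nat \<lfloor>h * real k\<rfloor>)) \<le> h * real k" using f by (auto simp: min_def)
  then have l'k: "real l' \<le> (1 - h) * real k" using \<zeta> by (simp add: l'_def algebra_simps)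
  moreover have "real l \<le> real l'" using l \<open>\<zeta> < l'\<close> by simp
  ultimately have lk: "real l \<le> (1 - h) * real k" by linarith
  have ll: "l < l'" using l \<open>\<zeta> < l'\<close> by simp
  have Zd: "Z < real (l' - l)"
  proof -
    have "min W (nat \<lfloor>h * real k\<rfloor>) \<le> l' - l" using l by (simp add: l'_def)
    then have "real (min W (nat \<lfloor>h * real k\<rfloor>)) \<le> real (l' - l)" by (simp only: of_nat_le_iff)
    then show ?thesis using Zl by linarith
  qed
  obtain x y where x: "is_first_moment q k m (real l / real k) x"
    "phi p k n \<omega> l = ereal y" "\<bar>y - real m * x\<bar> \<le> C * ln (real k)"
    using first_moment_closeE[OF close[OF lk]] unfolding q_def m_def by blast
  obtain x' y' where x': "is_first_moment q k m (real l' / real k) x'"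
    "phi p k n \<omega> l' = ereal y'" "\<bar>y' - real m * x'\<bar> \<le> C * ln (real k)"
    using first_moment_closeE[OF close[OF l'k]] unfolding q_def m_def by blast
  have c3: "real k * (K * ((1 / 2 - \<delta>) * v)) \<le> K * M" if "0 \<le> K" for K
    using mult_left_mono[OF B(4) that] by (simp add: mult_ac)
  have a0: "0 \<le> a" by (simp add: a_def)
  have main: "x - x' \<ge> (R - 1 / 2) * a\<^sup>2 / 2 * ln 2 * (real (l' - l) / real k)"
  proof (rule first_moment_decrease[OF x(1) x'(1) ll _ k0 _ h _ R(2)])
    show "real l' + h * real k \<le> real k" using l'k by (simp add: algebra_simps)
    show "k \<le> q - k" by (rule B(1))
    show "0 < R - 1 / 2" using R by simp
    show "(R - 1 / 2) * (real m * ln 2) \<le> real k * ln (real (q - k) / real k)"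
      using B(2) by (simp add: M_def)
    show "real k * ln (real (q - k) / real k) \<le> R * (real m * ln 2)"
      using B(3) by (simp add: M_def)
    show "a = ((1 - R) / 2 * (h * ln 2) / 4)\<^sup>2" by (simp add: a_def)
    have "real k * (ln 2 / h + ln (1 / h) + 1) \<le> real k * ((1 - R) / 2 * ((1 / 2 - \<delta>) * v))"
      using v1 by (intro mult_left_mono) auto
    also have "\<dots> \<le> (1 - R) / 2 * M" using R by (intro c3) simp
    finally show "real k * (ln 2 / h + ln (1 / h) + 1) \<le> (1 - R) / 2 * (real m * ln 2)"
      by (simp only: M_def)
    have "real k * (2 * ln (1 / h)) \<le> real k * ((R - 1 / 2) * a / 2 * ((1 / 2 - \<delta>) * v))"
      using v2 by (intro mult_left_mono) auto
    also have "\<dots> \<le> (R - 1 / 2) * a / 2 * M" using R a0 by (intro c3) simp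
    finally show "real k * (2 * ln (1 / h)) \<le> (R - 1 / 2) * a / 2 * (real m * ln 2)"
      by (simp only: M_def)
  qed
  define D where "D = (R - 1 / 2) * a\<^sup>2 / 2"
  have D0: "0 \<le> D" using R by (simp add: D_def)
  have lnk: "ln (real k) > 0" using k by simp
  \<comment> \<open>Per step \<open>m * F\<close> falls by at least \<open>D * M / k\<close>, and
    \<open>M / k\<close> is at least \<open>(1 / 2 - \<delta>) * v\<close>, hence at least a
    constant times \<open>ln k\<close>.\<close>
  have "2 * C * ln (real k) < D * ((1 / 2 - \<delta>) * c) * Z * ln (real k)"
    using Z lnk by (intro mult_strict_right_mono) (auto simp: D_def)
  also have "\<dots> = D * Z * ((1 / 2 - \<delta>) * (c * ln (real k)))" by (simp add: mult_ac)
  also have "\<dots> \<le> D * Z * ((1 / 2 - \<delta>) * v)"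
    using c \<delta> D0 W by (intro mult_left_mono) auto
  also have "\<dots> \<le> D * real (l' - l) * ((1 / 2 - \<delta>) * v)"
    using Zd D0 \<delta> by (intro mult_right_mono mult_left_mono) (auto simp: v_def)
  also have "\<dots> \<le> D * real (l' - l) * (M / real k)"
    using B(4) D0 k0 by (intro mult_left_mono) (auto simp: pos_le_divide_eq mult_ac)
  also have "\<dots> = real m * (D * ln 2 * (real (l' - l) / real k))" by (simp add: M_def)
  also have "\<dots> \<le> real m * (x - x')"
    using main by (intro mult_left_mono) (auto simp: D_def)
  finally have "2 * C * ln (real k) < real m * x - real m * x'" by (simp add: right_diff_distrib)
  then have "y' < y" using x(3) x'(3) by (simp add: abs_le_iff)
  then have "phi p k n \<omega> l' < phi p k n \<omega> l" by (simp add: x x')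
  then show "\<exists>l'>\<zeta>. l' \<le> \<zeta> + W \<and> phi p k n \<omega> l' < phi p k n \<omega> l"
    using \<open>\<zeta> < l'\<close> \<open>l' \<le> \<zeta> + W\<close> by blast
qed

theorem theoremB11:
  fixes k n :: "nat \<Rightarrow> nat" and R c :: real
  assumes R: "1 / 2 < R" "R < 1"
    and k_at_top: "filterlim k at_top sequentially"
    and k_small: "(\<lambda>p. real (k p)) \<in> o(\<lambda>p. real p)"
    and c: "0 < c" "\<forall>\<^sub>F p in sequentially. real (k p) \<le> real p powr (1 - c)"
    and rate: "\<forall>\<^sub>F p in sequentially. \<bar>real (n p) - log 2 (real (p choose k p)) / R\<bar> < 1"
    and first_moment_hyp:
      "\<forall>\<epsilon>>0. \<exists>C::real.
         aas (\<lambda>p. group_testing p (k p) (n p))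
             (\<lambda>p \<omega>. \<forall>l::nat. int l \<le> \<lfloor>(1 - \<epsilon>) * real (k p)\<rfloor> \<longrightarrow>
                first_moment_close p (k p) (n p) \<omega> l (C * ln (real (k p))))"
  shows "\<forall>\<epsilon>>0. \<forall>w::nat \<Rightarrow> real. filterlim w at_top sequentially \<longrightarrow>
         aas (\<lambda>p. group_testing p (k p) (n p))
             (\<lambda>p \<omega>. \<forall>\<zeta>\<in>{0..k p}. \<forall>W\<in>{0..k p}. \<forall>H\<^sub>0::real.
                real \<zeta> \<le> (1 - \<epsilon>) * real (k p) \<and> \<zeta> + W \<le> k p \<and> w p \<le> real W \<and> 0 < H\<^sub>0 \<longrightarrow>
                \<not> OGP p (k p) (n p) \<omega> \<zeta> W H\<^sub>0)"
proof (intro allI impI)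
  fix \<epsilon> :: real and w :: "nat \<Rightarrow> real"
  assume \<epsilon>: "0 < \<epsilon>" and w: "filterlim w at_top sequentially"
  \<comment> \<open>As \<open>2 * h \<le> \<epsilon>\<close>, at least \<open>h * k\<close> steps
    remain between \<open>\<zeta> \<le> (1 - \<epsilon>) * k\<close> and \<open>(1 - h) * k\<close>,
    up to which the hypothesis, taken with \<open>h\<close>, controls \<open>phi\<close>. The
    minimum keeps \<open>h \<le> 1\<close> for large \<open>\<epsilon>\<close>.\<close>
  define h where "h = min \<epsilon> 1 / 2"
  have h: "0 < h" "h \<le> 1" "2 * h \<le> \<epsilon>" using \<epsilon> by (auto simp: h_def)
  define L where "L = (\<lambda>p. ln (real p / real (k p)))"
  define v where "v = (\<lambda>p. real (n p) * ln 2 / real (k p))"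
  note ra = rate_asymptotics[OF _ k_at_top k_small rate]
  have L: "filterlim L at_top sequentially" and vL: "(\<lambda>p. v p / L p) \<longlonglongrightarrow> 1 / R"
    unfolding L_def v_def using ra R by auto
  obtain \<delta> where \<delta>: "0 < \<delta>" "\<delta> < 1 / 2"
    and up: "\<forall>\<^sub>F p in sequentially. L p + ln 2 \<le> (1 + R) * ((1 / 2 - \<delta>) * v p)"
    and lo: "\<forall>\<^sub>F p in sequentially. (1 / 2 + R) * ((1 / 2 + \<delta>) * v p) \<le> L p - 2 * ln 2"
    and Lv: "\<forall>\<^sub>F p in sequentially. L p \<le> v p"
    using rate_eventually_bounds[OF R L vL] by blast
  have v: "filterlim v at_top sequentially" using filterlim_at_top_mono[OF L Lv] .
  have kreal: "filterlim (\<lambda>p. real (k p)) at_top sequentially"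
    using filterlim_compose[OF filterlim_real_sequentially k_at_top] .
  have k0: "\<forall>\<^sub>F p in sequentially. 0 < k p \<and> 2 * k p \<le> p"
    using eventually_compose_filterlim[OF eventually_gt_at_top[of 0] k_at_top]
      filterlim_at_top_dense[THEN iffD1, OF items_per_defective_at_top[OF k_at_top k_small], rule_format, of 2]
    by eventually_elim (simp add: field_simps)
  have tp: "aas (\<lambda>p. group_testing p (k p) (n p)) (\<lambda>p. typical \<delta> p (k p) (n p))"
    by (rule aas_typical[OF R(1) \<delta>(1) k0 L[unfolded L_def] lo[unfolded L_def v_def] Lv[unfolded L_def v_def]])
  obtain C where close: "aas (\<lambda>p. group_testing p (k p) (n p))
             (\<lambda>p \<omega>. \<forall>l::nat. int l \<le> \<lfloor>(1 - h) * real (k p)\<rfloor> \<longrightarrow>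
                first_moment_close p (k p) (n p) \<omega> l (C * ln (real (k p))))"
    using first_moment_hyp h(1) by blast
  define a where "a = ((1 - R) / 2 * (h * ln 2) / 4)\<^sup>2"
  define E where "E = (R - 1 / 2) * a\<^sup>2 / 2 * ((1 / 2 - \<delta>) * c)"
  have a: "a > 0" using R h by (simp add: a_def)
  have E: "E > 0" unfolding E_def using R a \<delta> c by (intro mult_pos_pos divide_pos_pos) auto
  \<comment> \<open>The fall of \<open>m * F\<close> per step is at least \<open>E * ln k\<close>,
    so \<open>Z\<close> steps outweigh twice the error \<open>C * ln k\<close>. The absolute value
    gives \<open>0 \<le> Z\<close>, the summand \<open>1\<close> strictness.\<close>
  define Z where "Z = (2 * \<bar>C\<bar> + 1) / E"
  have Z: "0 \<le> Z" "2 * C < E * Z" using E by (auto simp: Z_def)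
  \<comment> \<open>From \<open>k \<le> p powr (1 - c)\<close> follows
    \<open>c * ln p \<le> ln p - ln k = L \<le> v\<close>.\<close>
  have lnk: "\<forall>\<^sub>F p in sequentially. c * ln (real (k p)) \<le> v p"
    using k0 Lv c(2)
  proof eventually_elim
    case (elim p)
    have "ln (real (k p)) \<le> ln (real p powr (1 - c))"
      using elim by (subst ln_le_cancel_iff) auto
    also have "\<dots> = (1 - c) * ln (real p)" using elim by (simp add: ln_powr)
    finally have "c * ln (real p) \<le> ln (real p) - ln (real (k p))" by (simp add: algebra_simps)
    also have "\<dots> = L p" using elim by (simp add: L_def ln_div)
    finally have "c * ln (real p) \<le> v p" using elim by linarith
    moreover have "c * ln (real (k p)) \<le> c * ln (real p)" using elim c by (intro mult_left_mono) auto
    ultimately show ?case by linarith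
  qed
  have ev: "\<forall>\<^sub>F p in sequentially. K \<le> b * ((1 / 2 - \<delta>) * v p)" if "0 < b" for K b
  proof -
    have "filterlim (\<lambda>p. (b * (1 / 2 - \<delta>)) * v p) at_top sequentially"
      using that \<delta> by (intro filterlim_tendsto_pos_mult_at_top[OF tendsto_const _ v]) auto
    then show ?thesis by (simp add: filterlim_at_top mult.assoc)
  qed
  have hk: "\<forall>\<^sub>F p in sequentially. Z + 1 < h * real (k p)"
    using filterlim_at_top_dense[THEN iffD1, OF filterlim_tendsto_pos_mult_at_top[OF tendsto_const h(1) kreal]]
    by blast
  show "aas (\<lambda>p. group_testing p (k p) (n p))
             (\<lambda>p \<omega>. \<forall>\<zeta>\<in>{0..k p}. \<forall>W\<in>{0..k p}. \<forall>H\<^sub>0::real.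
                real \<zeta> \<le> (1 - \<epsilon>) * real (k p) \<and> \<zeta> + W \<le> k p \<and> w p \<le> real W \<and> 0 < H\<^sub>0 \<longrightarrow>
                \<not> OGP p (k p) (n p) \<omega> \<zeta> W H\<^sub>0)"
  proof (rule aas_mono2[OF tp close])
    have "0 < (1 - R) / 2" "0 < (R - 1 / 2) * a / 2" using R a by auto
    note evs = ev[OF this(1), of "ln 2 / h + ln (1 / h) + 1"] ev[OF this(2), of "2 * ln (1 / h)"]
    \<comment> \<open>Given the two almost sure events, the rest holds for all large
      \<open>p\<close>, uniformly in the outcome and the gap parameters; \<open>w\<close> at
      infinity provides \<open>Z < W\<close>.\<close>
    show "\<forall>\<^sub>F p in sequentially. \<forall>\<omega>. typical \<delta> p (k p) (n p) \<omega> \<and>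
        (\<forall>l::nat. int l \<le> \<lfloor>(1 - h) * real (k p)\<rfloor> \<longrightarrow>
           first_moment_close p (k p) (n p) \<omega> l (C * ln (real (k p)))) \<longrightarrow>
        (\<forall>\<zeta>\<in>{0..k p}. \<forall>W\<in>{0..k p}. \<forall>H\<^sub>0::real.
            real \<zeta> \<le> (1 - \<epsilon>) * real (k p) \<and> \<zeta> + W \<le> k p \<and> w p \<le> real W \<and> 0 < H\<^sub>0 \<longrightarrow>
            \<not> OGP p (k p) (n p) \<omega> \<zeta> W H\<^sub>0)"
      using k0 up lo lnk evs hk eventually_compose_filterlim[OF eventually_gt_at_top[of 1] k_at_top]
        filterlim_at_top_dense[THEN iffD1, OF w, rule_format, of Z]
    proof eventually_elim
      case (elim p)
      note e = elim
      show ?case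
      proof (intro allI impI ballI, elim conjE)
        fix \<omega> \<zeta> W and H\<^sub>0 :: real
        assume tp: "typical \<delta> p (k p) (n p) \<omega>"
          and close: "\<forall>l::nat. int l \<le> \<lfloor>(1 - h) * real (k p)\<rfloor> \<longrightarrow>
             first_moment_close p (k p) (n p) \<omega> l (C * ln (real (k p)))"
          and \<zeta>: "real \<zeta> \<le> (1 - \<epsilon>) * real (k p)" and W: "w p \<le> real W"
        have \<zeta>': "real \<zeta> \<le> (1 - 2 * h) * real (k p)"
          using \<zeta> mult_right_mono[of "1 - \<epsilon>" "1 - 2 * h" "real (k p)"] h by simp
        have close': "first_moment_close p (k p) (n p) \<omega> l (C * ln (real (k p)))"
          if "real l \<le> (1 - h) * real (k p)" for l
          using close that by (simp add: le_floor_iff)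
        show "\<not> OGP p (k p) (n p) \<omega> \<zeta> W H\<^sub>0"
          using e W \<zeta>' Z
          by (intro no_OGP_of_typical[OF tp close' _ _ R \<delta> h(1,2) _ _ _ _ c(1), where Z = Z])
            (auto simp: L_def v_def a_def E_def)
      qed
    qed
  qed
qed

end
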